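(* There exist a symbolic space $X=\mathcal A^{\mathbb N}$ ($\mathcal A$ a finite alphabet), endowed with the uniform Bernoulli measure as reference measure, and computable maps $T':X\to X$ and $T'':X\to X$ such that: - $T'$ has a computable metric attractor and a $\Pi_2$-complete topological attractor; - $T''$ has a $\Pi_2$-complete metric attractor and a computable topological attractor.
   Context: **Symbolic space.** On $X=\mathcal A^{\mathbb N}$, $\mathcal A$ a finite alphabet, the distance is $d(x,y)=2^{-\min\{n:x_n\ne y_n\}}$; the ideal points are the eventually constant sequences $w0^\infty$, $w\in\mathcal A^*$ (with $0\in\mathcal A$ a fixed letter). The ideal balls are the open balls with ideal center and positive rational radius (they are cylinders); $(B_i)_{i\in\mathbb N}$ is a fixed computable enumeration of them, and $\overline{B_i}$ is the closed ball with the same center and radius. A map $T:X\to X$ is computable iff there are a non-decreasing computable function $\varphi:\mathbb N\to\mathbb N$ and an algorithm which, given the first $\varphi(n)$ symbols of $x$, computes the first $n$ symbols of $T(x)$. **Complexity of closed sets.** A closed set $E\subset X$ is computable if it is both lower computable (the set $\{i:E\cap B_i\neq\emptyset\}$ is recursively enumerable) and upper computable (there is a recursively enumerable $I\subset\mathbb N$ with $X\setminus E=\bigcup_{i\in I}B_i$). A compact set $K$ is $\Pi_n$ if its outer collection $\{i:\overline{B_i}\cap K=\emptyset\}$ is a $\Sigma_n$ set of integers (arithmetical hierarchy). $K$ is $\Pi_n$-complete if it is $\Pi_n$ and any other $\Pi_n$ compact set $K'$ can be reduced to $K$, in the sense that, provided with an enumeration of the outer collection of $K$, we can (algorithmically)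 enumerate the outer collection of $K'$. **Attractors** (of a continuous map $T:X\to X$). $\omega(x)$ is the set of accumulation points of $x,T(x),T^2(x),\dots$. For a closed set $A$, $\rho(A)=\{x:\omega(x)\subset A\}$. A set is generic if it contains a countable intersection of open dense sets; meager sets are complements of generic sets. A closed set $A$ is a metric attractor (with respect to a reference measure $\lambda$) if $\rho(A)$ has full $\lambda$-measure and no strictly smaller closed $A'\subset A$ has $\lambda(\rho(A'))>0$. It is a topological attractor if $\rho(A)$ is generic and no strictly smaller closed $A'\subset A$ has $\rho(A')$ non-meager. *)

theory Defs
  imports "HOL-Probability.Probability" "HOL-Library.Nat_Bijection"
begin

section \<open>Computability on the natural numbers\<close>

text \<open>
  Partial recursive functions with an oracle, in unary form: several arguments are passed through
  the pairing bijection \<^const>\<open>prod_encode\<close>. \<open>Prec c d\<close> is primitive recursion with parameter and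
  \<open>Mu c\<close> is unbounded minimisation, which is undefined as soon as \<open>c\<close> diverges before the first
  zero. The oracle is part of the syntax, so that a single program can be run on every oracle.
\<close>

datatype program =
    Zero
  | Succ
  | Fst
  | Snd
  | Pairing program program
  | Comp program program
  | Prec program program
  | Mu program
  | Oracle

primrec run :: "program \<Rightarrow> (nat \<Rightarrow> nat) \<Rightarrow> nat \<Rightarrow> nat option" where
  "run Zero f x = Some 0"
| "run Succ f x = Some (Suc x)"
| "run Fst f x = Some (fst (prod_decode x))"
| "run Snd f x = Some (snd (prod_decode x))"
| "run (Pairing c d) f x =
     Option.bind (run c f x) (\<lambda>a. Option.bind (run d f x) (\<lambda>b. Some (prod_encode (a, b))))"
| "run (Comp c d) f x = Option.bind (run d f x) (run c f)"
| "run (Prec c d) f x =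
     rec_nat (run c f (fst (prod_decode x)))
       (\<lambda>m r. Option.bind r (\<lambda>v. run d f (prod_encode (fst (prod_decode x), prod_encode (m, v)))))
       (snd (prod_decode x))"
| "run (Mu c) f x =
     (if \<exists>n. run c f (prod_encode (x, n)) = Some 0 \<and>
             (\<forall>m<n. run c f (prod_encode (x, m)) \<noteq> None)
      then Some (LEAST n. run c f (prod_encode (x, n)) = Some 0)
      else None)"
| "run Oracle f x = Some (f x)"

text \<open>Computation without oracle is computation with the zero oracle, which adds no power.\<close>

definition computable_fun :: "(nat \<Rightarrow> nat) \<Rightarrow> bool" where
  "computable_fun g \<longleftrightarrow> (\<exists>c. \<forall>x. run c (\<lambda>_. 0) x = Some (g x))"

definition decidable :: "nat set \<Rightarrow> bool" where
  "decidable A \<longleftrightarrow> computable_fun (\<lambda>x. if x \<in> A then 1 else 0)"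

text \<open>
  At each step an enumeration either outputs a number \<open>i\<close> (value \<open>Suc i\<close>) or outputs nothing
  (value \<open>0\<close>), so the empty set has an enumeration too.
\<close>

definition enumerates :: "(nat \<Rightarrow> nat) \<Rightarrow> nat set \<Rightarrow> bool" where
  "enumerates f A \<longleftrightarrow> A = {i. \<exists>n. f n = Suc i}"

definition rec_enumerable :: "nat set \<Rightarrow> bool" where
  "rec_enumerable A \<longleftrightarrow> (\<exists>f. computable_fun f \<and> enumerates f A)"

text \<open>One algorithm turns every enumeration of \<open>B\<close>, given as oracle, into an enumeration of \<open>A\<close>.\<close>

definition enum_reducible :: "nat set \<Rightarrow> nat set \<Rightarrow> bool" where
  "enum_reducible A B \<longleftrightarrow>
     (\<exists>c. \<forall>f. enumerates f B \<longrightarrow> (\<exists>g. (\<forall>n. run c f n = Some (g n)) \<and> enumerates g A))"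

text \<open>
  Level \<open>0\<close> consists of the decidable sets; a set is \<open>\<Sigma>\<close> at level \<open>n + 1\<close> iff it is the projection
  of a set that is \<open>\<Pi>\<close> at level \<open>n\<close>, i.e. whose complement is \<open>\<Sigma>\<close> at level \<open>n\<close>.
\<close>

primrec arith_sigma :: "nat \<Rightarrow> nat set \<Rightarrow> bool" where
  "arith_sigma 0 A \<longleftrightarrow> decidable A"
| "arith_sigma (Suc n) A \<longleftrightarrow>
     (\<exists>B. arith_sigma n (- B) \<and> A = {x. \<exists>y. prod_encode (x, y) \<in> B})"


section \<open>Symbolic spaces\<close>

text \<open>The alphabet with \<open>k\<close> letters is \<open>{0, \<dots>, k - 1}\<close>, with distinguished letter \<open>0\<close>.\<close>

definition symb :: "nat \<Rightarrow> (nat \<Rightarrow> nat) set" where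
  "symb k = {x. \<forall>n. x n < k}"

definition symb_dist :: "(nat \<Rightarrow> nat) \<Rightarrow> (nat \<Rightarrow> nat) \<Rightarrow> real" where
  "symb_dist x y = (if x = y then 0 else (1 / 2) ^ (LEAST n. x n \<noteq> y n))"

lemma symb_dist_less_iff: "symb_dist x y < (1 / 2) ^ n \<longleftrightarrow> (\<forall>i\<le>n. x i = y i)"
proof (cases "x = y")
  case False
  then obtain j where j: "x j \<noteq> y j" by auto
  define m where "m = (LEAST n. x n \<noteq> y n)"
  have m: "x m \<noteq> y m" "\<And>i. i < m \<Longrightarrow> x i = y i"
    unfolding m_def using LeastI[of "\<lambda>n. x n \<noteq> y n", OF j] not_less_Least by blast+
  have "symb_dist x y < (1 / 2) ^ n \<longleftrightarrow> n < m"
    using False by (simp add: symb_dist_def m_def)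
  also have "\<dots> \<longleftrightarrow> (\<forall>i\<le>n. x i = y i)"
    using m by (meson le_less_trans not_less)
  finally show ?thesis .
qed (simp add: symb_dist_def)

lemma Metric_space_symb: "Metric_space (symb k) symb_dist"
proof
  fix x y z :: "nat \<Rightarrow> nat"
  show "0 \<le> symb_dist x y" by (simp add: symb_dist_def)
  show "symb_dist x y = symb_dist y x" by (simp add: symb_dist_def eq_commute)
  show "symb_dist x y = 0 \<longleftrightarrow> x = y" by (simp add: symb_dist_def)
  show "symb_dist x z \<le> symb_dist x y + symb_dist y z"
  proof (cases "x = z")
    case False
    define m where "m = (LEAST n. x n \<noteq> z n)"
    have eq: "symb_dist x z = (1 / 2) ^ m" using False by (simp add: symb_dist_def m_def)
    have "\<exists>n. x n \<noteq> z n" using False by auto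
    then have "x m \<noteq> z m" unfolding m_def by (rule LeastI_ex)
    then have "\<not> (symb_dist x y < (1 / 2) ^ m \<and> symb_dist y z < (1 / 2) ^ m)"
      by (auto simp: symb_dist_less_iff)
    moreover have "0 \<le> symb_dist x y" "0 \<le> symb_dist y z" by (auto simp: symb_dist_def)
    ultimately show ?thesis unfolding eq by linarith
  qed (simp add: symb_dist_def)
qed

abbreviation symb_top :: "nat \<Rightarrow> (nat \<Rightarrow> nat) topology" where
  "symb_top k \<equiv> Metric_space.mtopology (symb k) symb_dist"

definition bernoulli :: "nat \<Rightarrow> (nat \<Rightarrow> nat) measure" where
  "bernoulli k = (\<Pi>\<^sub>M n\<in>UNIV. uniform_count_measure {..<k})"

lemma space_bernoulli: "space (bernoulli k) = symb k"
  by (simp add: bernoulli_def symb_def space_PiM space_uniform_count_measure PiE_UNIV_domain Pi_def)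

lemma prob_space_bernoulli: "0 < k \<Longrightarrow> prob_space (bernoulli k)"
  unfolding bernoulli_def by (intro prob_space_PiM prob_space_uniform_count_measure) auto

text \<open>
  The index \<open>i\<close> codes a word and a pair \<open>(p, q)\<close>, standing for the center \<open>w000\<dots>\<close> and the radius
  \<open>(p + 1) / (q + 1)\<close>. Letters are reduced modulo \<open>k\<close>, so that every index codes a ball.
\<close>

definition ideal_center :: "nat \<Rightarrow> nat \<Rightarrow> nat \<Rightarrow> nat" where
  "ideal_center k i =
     (let w = list_decode (fst (prod_decode i)) in (\<lambda>n. if n < length w then w ! n mod k else 0))"

definition ideal_radius :: "nat \<Rightarrow> real" where
  "ideal_radius i =
     (let (p, q) = prod_decode (snd (prod_decode i)) in real (Suc p) / real (Suc q))"

definition ideal_ball :: "nat \<Rightarrow> nat \<Rightarrow> (nat \<Rightarrow> nat) set" where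
  "ideal_ball k i = Metric_space.mball (symb k) symb_dist (ideal_center k i) (ideal_radius i)"

definition ideal_cball :: "nat \<Rightarrow> nat \<Rightarrow> (nat \<Rightarrow> nat) set" where
  "ideal_cball k i = Metric_space.mcball (symb k) symb_dist (ideal_center k i) (ideal_radius i)"

lemma ideal_balls_exhaustive:
  assumes "set w \<subseteq> {..<k}" "r \<in> \<rat>" "0 < r"
  shows "\<exists>i. ideal_center k i = (\<lambda>n. if n < length w then w ! n else 0) \<and> ideal_radius i = r"
proof -
  obtain a b :: nat where ab: "b \<noteq> 0" "\<bar>r\<bar> = real a / real b"
    using Rats_abs_nat_div_natE[OF assms(2)] by metis
  have "a \<noteq> 0"
  proof
    assume "a = 0"
    with ab assms(3) show False by simp
  qed
  define i where "i = prod_encode (list_encode w, prod_encode (a - 1, b - 1))"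
  have "w ! n mod k = w ! n" if "n < length w" for n
    using assms(1) nth_mem[OF that] by (metis lessThan_iff mod_less subsetD)
  then have "ideal_center k i = (\<lambda>n. if n < length w then w ! n else 0)"
    by (auto simp: ideal_center_def i_def)
  moreover have "ideal_radius i = r"
    using ab \<open>a \<noteq> 0\<close> assms(3) by (simp add: ideal_radius_def i_def)
  ultimately show ?thesis by blast
qed

definition prefix_code :: "(nat \<Rightarrow> nat) \<Rightarrow> nat \<Rightarrow> nat" where
  "prefix_code x n = list_encode (map x [0..<n])"

definition computable_map :: "nat \<Rightarrow> ((nat \<Rightarrow> nat) \<Rightarrow> (nat \<Rightarrow> nat)) \<Rightarrow> bool" where
  "computable_map k T \<longleftrightarrow>
     T \<in> symb k \<rightarrow> symb k \<and>
     (\<exists>\<phi> c. mono \<phi> \<and> computable_fun \<phi> \<and>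
        (\<forall>x\<in>symb k. \<forall>n.
           run c (\<lambda>_. 0) (prod_encode (n, prefix_code x (\<phi> n))) = Some (prefix_code (T x) n)))"


section \<open>Complexity of closed sets\<close>

definition lower_computable :: "nat \<Rightarrow> (nat \<Rightarrow> nat) set \<Rightarrow> bool" where
  "lower_computable k E \<longleftrightarrow> rec_enumerable {i. E \<inter> ideal_ball k i \<noteq> {}}"

definition upper_computable :: "nat \<Rightarrow> (nat \<Rightarrow> nat) set \<Rightarrow> bool" where
  "upper_computable k E \<longleftrightarrow> (\<exists>I. rec_enumerable I \<and> symb k - E = (\<Union>i\<in>I. ideal_ball k i))"

definition computable_closed :: "nat \<Rightarrow> (nat \<Rightarrow> nat) set \<Rightarrow> bool" where
  "computable_closed k E \<longleftrightarrow>
     closedin (symb_top k) E \<and> lower_computable k E \<and> upper_computable k E"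

definition outer_collection :: "nat \<Rightarrow> (nat \<Rightarrow> nat) set \<Rightarrow> nat set" where
  "outer_collection k K = {i. ideal_cball k i \<inter> K = {}}"

definition Pi_compact :: "nat \<Rightarrow> nat \<Rightarrow> (nat \<Rightarrow> nat) set \<Rightarrow> bool" where
  "Pi_compact k n K \<longleftrightarrow> compactin (symb_top k) K \<and> arith_sigma n (outer_collection k K)"

definition Pi_complete :: "nat \<Rightarrow> nat \<Rightarrow> (nat \<Rightarrow> nat) set \<Rightarrow> bool" where
  "Pi_complete k n K \<longleftrightarrow>
     Pi_compact k n K \<and>
     (\<forall>K'. Pi_compact k n K' \<longrightarrow> enum_reducible (outer_collection k K') (outer_collection k K))"


section \<open>Attractors\<close>

definition omega_limit ::
    "nat \<Rightarrow> ((nat \<Rightarrow> nat) \<Rightarrow> (nat \<Rightarrow> nat)) \<Rightarrow> (nat \<Rightarrow> nat) \<Rightarrow> (nat \<Rightarrow> nat) set" where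
  "omega_limit k T x =
     {y \<in> symb k. \<forall>U. openin (symb_top k) U \<and> y \<in> U \<longrightarrow> (\<exists>\<^sub>\<infinity>n. (T ^^ n) x \<in> U)}"

definition basin ::
    "nat \<Rightarrow> ((nat \<Rightarrow> nat) \<Rightarrow> (nat \<Rightarrow> nat)) \<Rightarrow> (nat \<Rightarrow> nat) set \<Rightarrow> (nat \<Rightarrow> nat) set" where
  "basin k T A = {x \<in> symb k. omega_limit k T x \<subseteq> A}"

definition generic :: "'a topology \<Rightarrow> 'a set \<Rightarrow> bool" where
  "generic X G \<longleftrightarrow>
     (\<exists>U :: nat \<Rightarrow> 'a set.
        (\<forall>n. openin X (U n) \<and> X closure_of (U n) = topspace X) \<and> (\<Inter>n. U n) \<subseteq> G)"

definition meager :: "'a topology \<Rightarrow> 'a set \<Rightarrow> bool" where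
  "meager X S \<longleftrightarrow> generic X (topspace X - S)"

text \<open>
  For continuous \<open>T\<close> and closed \<open>A\<close> the basin of \<open>A\<close> is a Borel set, so \<^const>\<open>emeasure\<close> is not
  applied to a non-measurable set.
\<close>

definition metric_attractor ::
    "nat \<Rightarrow> ((nat \<Rightarrow> nat) \<Rightarrow> (nat \<Rightarrow> nat)) \<Rightarrow> (nat \<Rightarrow> nat) set \<Rightarrow> bool" where
  "metric_attractor k T A \<longleftrightarrow>
     closedin (symb_top k) A \<and>
     emeasure (bernoulli k) (basin k T A) = 1 \<and>
     (\<nexists>A'. closedin (symb_top k) A' \<and> A' \<subset> A \<and> 0 < emeasure (bernoulli k) (basin k T A'))"

definition topological_attractor ::
    "nat \<Rightarrow> ((nat \<Rightarrow> nat) \<Rightarrow> (nat \<Rightarrow> nat)) \<Rightarrow> (nat \<Rightarrow> nat) set \<Rightarrow> bool" where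
  "topological_attractor k T A \<longleftrightarrow>
     closedin (symb_top k) A \<and>
     generic (symb_top k) (basin k T A) \<and>
     (\<nexists>A'. closedin (symb_top k) A' \<and> A' \<subset> A \<and> \<not> meager (symb_top k) (basin k T A'))"

end

theory Submission
  imports Defs
begin

text \<open>
  Both maps shift a tape: a point \<open>u 2 y\<close>, with the \<open>2\<close> as a marker, carries a word
  \<open>u\<close> whose first letter is deleted in each step while a longer word is appended at its end, so
  that in the limit only the appended words are seen. An appended word has ones exactly at \<open>0\<close>
  and \<open>c\<close>, where \<open>c\<close> is the number written in this step, and ends with more and more
  zeros. So the limit set of \<open>u 2 y\<close> consists of \<open>0 0 \<dots>\<close> and the points with
  ones exactly at \<open>j\<close> and \<open>j + c\<close>, where \<open>c\<close> ranges over the numbers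
  that are written infinitely often. The number written in a step comes from a sequence \<open>h\<close> if
  the unread part \<open>y\<close> of the point, which is shifted too, starts with a number of zeros equal to
  the length of \<open>u\<close>, and from a sequence \<open>g\<close> otherwise. By Borel-Cantelli the first
  case occurs only finitely often for almost every point, so the metric attractor is determined by the numbers
  that \<open>g\<close> takes infinitely often; a generic point also writes infinitely often every number that
  \<open>h\<close> takes infinitely often. A sequence taking infinitely often exactly the elements of a
  universal \<open>\<Pi>\<^sub>2\<close> set, obtained from a universal machine, is put in the place of
  \<open>h\<close> with \<open>g = 0\<close> for the first map, and in the place of \<open>g\<close> for the
  second map, where \<open>h\<close> takes every value infinitely often.
\<close>

section \<open>Computable functions\<close>

definition p1 :: "nat \<Rightarrow> nat" where "p1 x = fst (prod_decode x)"
definition p2 :: "nat \<Rightarrow> nat" where "p2 x = snd (prod_decode x)"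
definition pr :: "nat \<Rightarrow> nat \<Rightarrow> nat" where "pr a b = prod_encode (a, b)"

lemma p1_pr [simp]: "p1 (pr a b) = a" and p2_pr [simp]: "p2 (pr a b) = b"
  by (simp_all add: p1_def p2_def pr_def)

lemma pr_p1_p2 [simp]: "pr (p1 x) (p2 x) = x"
  by (simp add: p1_def p2_def pr_def)

lemma pr_eq_iff [simp]: "pr a b = pr c d \<longleftrightarrow> a = c \<and> b = d"
  by (simp add: pr_def)

lemma pr_0_0 [simp]: "pr 0 0 = 0"
  by (simp add: pr_def prod_encode_def)

text \<open>The code \<open>0\<close> will also be the empty stack of the universal machine: it
  splits into zeros, so it looks like a stack whose top frame has tag \<open>0\<close>.\<close>

lemma p1_0 [simp]: "p1 0 = 0" and p2_0 [simp]: "p2 0 = 0"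
  using p1_pr[of 0 0] p2_pr[of 0 0] by simp_all

text \<open>One program has to work for every oracle. This is more than
  \<open>computable_fun\<close> asks for, and it lets such programs be used as parts of a program
  that does consult its oracle, as in \<open>Pi_complete_spikes\<close>.\<close>

definition recursive :: "(nat \<Rightarrow> nat) \<Rightarrow> bool" where
  "recursive g \<longleftrightarrow> (\<exists>c. \<forall>f x. run c f x = Some (g x))"

lemma recursive_imp_computable_fun: "recursive g \<Longrightarrow> computable_fun g"
  by (auto simp: recursive_def computable_fun_def)

named_theorems recursive_intro

lemma recursive_p1' : "recursive p1" and recursive_p2': "recursive p2"
  unfolding recursive_def p1_def p2_def by (metis run.simps(3), metis run.simps(4))

lemma recursive_compose: "recursive g \<Longrightarrow> recursive a \<Longrightarrow> recursive (\<lambda>x. g (a x))"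
proof -
  assume "recursive g" "recursive a"
  then obtain c d where "\<And>f x. run c f x = Some (g x)" "\<And>f x. run d f x = Some (a x)"
    unfolding recursive_def by metis
  then have "\<forall>f x. run (Comp c d) f x = Some (g (a x))" by simp
  then show ?thesis unfolding recursive_def by blast
qed

lemma recursive_pr [recursive_intro]: "recursive a \<Longrightarrow> recursive b \<Longrightarrow> recursive (\<lambda>x. pr (a x) (b x))"
proof -
  assume "recursive a" "recursive b"
  then obtain c d where "\<And>f x. run c f x = Some (a x)" "\<And>f x. run d f x = Some (b x)"
    unfolding recursive_def by metis
  then have "\<forall>f x. run (Pairing c d) f x = Some (pr (a x) (b x))" by (simp add: pr_def)
  then show ?thesis unfolding recursive_def by blast
qed

lemma recursive_p1 [recursive_intro]: "recursive a \<Longrightarrow> recursive (\<lambda>x. p1 (a x))"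
  by (rule recursive_compose[OF recursive_p1'])
lemma recursive_p2 [recursive_intro]: "recursive a \<Longrightarrow> recursive (\<lambda>x. p2 (a x))"
  by (rule recursive_compose[OF recursive_p2'])

lemma recursive_id [recursive_intro]: "recursive (\<lambda>x. x)"
  using recursive_pr[OF recursive_p1' recursive_p2'] by simp

lemma recursive_Suc [recursive_intro]: "recursive a \<Longrightarrow> recursive (\<lambda>x. Suc (a x))"
proof -
  have "recursive Suc" unfolding recursive_def by (metis run.simps(2))
  then show "recursive a \<Longrightarrow> recursive (\<lambda>x. Suc (a x))" by (rule recursive_compose)
qed

lemma recursive_const [recursive_intro]: "recursive (\<lambda>x. n)"
proof (induction n)
  case 0
  then show ?case unfolding recursive_def by (metis run.simps(1))
qed (rule recursive_Suc)

lemma recursive_app2: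
  assumes "recursive (\<lambda>z. g (p1 z) (p2 z))" "recursive a" "recursive b"
  shows "recursive (\<lambda>x. g (a x) (b x))"
  using recursive_compose[OF assms(1) recursive_pr[OF assms(2,3)]] by simp

text \<open>The whole argument \<open>x\<close> is handed to \<open>Prec\<close> as its parameter,
  so base, step and number of rounds may all depend on it. Most closure properties below are reduced
  to this one.\<close>

lemma recursive_rec [recursive_intro]:
  assumes "recursive a" "recursive (\<lambda>z. s (p1 z) (p1 (p2 z)) (p2 (p2 z)))" "recursive n"
  shows "recursive (\<lambda>x. rec_nat (a x) (\<lambda>m r. s x m r) (n x))"
proof -
  from assms(1,2) obtain c d where c: "\<And>f x. run c f x = Some (a x)"
    and d: "\<And>f z. run d f z = Some (s (p1 z) (p1 (p2 z)) (p2 (p2 z)))"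
    unfolding recursive_def by metis
  have "run (Prec c d) f z = Some (rec_nat (a (p1 z)) (\<lambda>m r. s (p1 z) m r) (p2 z))" for f z
  proof -
    have "rec_nat (run c f (p1 z))
       (\<lambda>m r. Option.bind r (\<lambda>v. run d f (pr (p1 z) (pr m v)))) k =
       Some (rec_nat (a (p1 z)) (\<lambda>m r. s (p1 z) m r) k)" for k
      by (induction k) (auto simp: c d)
    then show ?thesis by (simp add: p1_def p2_def pr_def)
  qed
  then have "recursive (\<lambda>z. rec_nat (a (p1 z)) (\<lambda>m r. s (p1 z) m r) (p2 z))"
    unfolding recursive_def by blast
  from recursive_compose[OF this recursive_pr[OF recursive_id assms(3)]] show ?thesis by simp
qed

section \<open>Decidable predicates, arithmetic and search\<close>

definition recursive_pred :: "(nat \<Rightarrow> bool) \<Rightarrow> bool" where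
  "recursive_pred P \<longleftrightarrow> recursive (\<lambda>x. if P x then 1 else 0)"

lemma recursive_pred_imp_decidable: "recursive_pred (\<lambda>x. x \<in> A) \<Longrightarrow> decidable A"
  by (simp add: recursive_pred_def decidable_def recursive_imp_computable_fun)

text \<open>A case distinction is a recursion with zero or one rounds.\<close>

lemma recursive_if [recursive_intro]:
  assumes "recursive_pred P" "recursive a" "recursive b"
  shows "recursive (\<lambda>x. if P x then a x else b x)"
proof -
  have "recursive (\<lambda>x. rec_nat (b x) (\<lambda>_ _. a x) (if P x then 1 else 0))"
    by (intro recursive_rec assms(3) assms(1)[unfolded recursive_pred_def] recursive_compose[OF assms(2) recursive_p1'])
  also have "(\<lambda>x. rec_nat (b x) (\<lambda>_ _. a x) (if P x then 1 else 0)) = (\<lambda>x. if P x then a x else b x)"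
    by auto
  finally show ?thesis .
qed

lemma recursive_pred_const [recursive_intro]: "recursive_pred (\<lambda>x. b)"
  unfolding recursive_pred_def by (rule recursive_const)

lemma recursive_pred_eq0: "recursive a \<Longrightarrow> recursive_pred (\<lambda>x. a x = 0)"
proof -
  assume "recursive a"
  then have "recursive (\<lambda>x. rec_nat 1 (\<lambda>_ _. 0) (a x))" by (intro recursive_intro)
  also have "(\<lambda>x. rec_nat 1 (\<lambda>_ _. 0) (a x)) = (\<lambda>x. if a x = 0 then 1 else 0)"
  proof
    show "rec_nat 1 (\<lambda>_ _. 0) (a x) = (if a x = 0 then 1 else 0)" for x by (cases "a x") auto
  qed
  finally show ?thesis unfolding recursive_pred_def .
qed

lemma recursive_pred_not [recursive_intro]:
  assumes "recursive_pred P" shows "recursive_pred (\<lambda>x. \<not> P x)"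
proof -
  have "(\<lambda>x. if \<not> P x then 1 else 0) = (\<lambda>x. if P x then 0 else (1::nat))" by auto
  then show ?thesis unfolding recursive_pred_def
    by (simp only:) (rule recursive_if[OF assms recursive_const recursive_const])
qed

lemma recursive_pred_if:
  assumes "recursive_pred P" "recursive_pred Q" "recursive_pred R" shows "recursive_pred (\<lambda>x. if P x then Q x else R x)"
proof -
  have "(\<lambda>x. if (if P x then Q x else R x) then 1 else (0::nat)) =
    (\<lambda>x. if P x then if Q x then 1 else 0 else if R x then 1 else 0)" by auto
  then show ?thesis unfolding recursive_pred_def
    by (simp only:) (rule recursive_if[OF assms(1) assms(2,3)[unfolded recursive_pred_def]])
qed

lemma recursive_pred_conj [recursive_intro]:
  assumes "recursive_pred P" "recursive_pred Q" shows "recursive_pred (\<lambda>x. P x \<and> Q x)"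
proof -
  have "(\<lambda>x. P x \<and> Q x) = (\<lambda>x. if P x then Q x else False)" by auto
  then show ?thesis
    by (simp only:) (rule recursive_pred_if[OF assms recursive_pred_const])
qed

lemma recursive_pred_disj [recursive_intro]:
  assumes "recursive_pred P" "recursive_pred Q" shows "recursive_pred (\<lambda>x. P x \<or> Q x)"
proof -
  have "(\<lambda>x. P x \<or> Q x) = (\<lambda>x. if P x then True else Q x)" by auto
  then show ?thesis
    by (simp only:) (rule recursive_pred_if[OF assms(1) recursive_pred_const assms(2)])
qed

lemma recursive_pred_imp [recursive_intro]:
  assumes "recursive_pred P" "recursive_pred Q" shows "recursive_pred (\<lambda>x. P x \<longrightarrow> Q x)"
  using recursive_pred_disj[OF recursive_pred_not[OF assms(1)] assms(2)] by (simp only: imp_conv_disj)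

lemma recursive_add [recursive_intro]: "recursive a \<Longrightarrow> recursive b \<Longrightarrow> recursive (\<lambda>x. a x + b x)"
proof -
  have "rec_nat m (\<lambda>_ r. Suc r) n = m + n" for m n by (induction n) auto
  then have "(\<lambda>x. a x + b x) = (\<lambda>x. rec_nat (a x) (\<lambda>_ r. Suc r) (b x))" by simp
  moreover assume "recursive a" "recursive b"
  then have "recursive (\<lambda>x. rec_nat (a x) (\<lambda>_ r. Suc r) (b x))" by (intro recursive_intro)
  ultimately show ?thesis by simp
qed

lemma recursive_mult [recursive_intro]: "recursive a \<Longrightarrow> recursive b \<Longrightarrow> recursive (\<lambda>x. a x * b x)"
proof -
  have "rec_nat 0 (\<lambda>_ r. r + m) n = m * n" for m n :: nat by (induction n) auto
  then have *: "(\<lambda>x. a x * b x) = (\<lambda>x. rec_nat 0 (\<lambda>_ r. r + a x) (b x))" by simp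
  assume a: "recursive a" and "recursive b"
  then show ?thesis unfolding * by (intro recursive_intro recursive_compose[OF a recursive_p1])
qed

lemma recursive_power [recursive_intro]: "recursive a \<Longrightarrow> recursive b \<Longrightarrow> recursive (\<lambda>x. a x ^ b x)"
proof -
  have "rec_nat 1 (\<lambda>_ r. r * m) n = m ^ n" for m n :: nat by (induction n) auto
  then have *: "(\<lambda>x. a x ^ b x) = (\<lambda>x. rec_nat 1 (\<lambda>_ r. r * a x) (b x))" by simp
  assume a: "recursive a" and "recursive b"
  then show ?thesis unfolding * by (intro recursive_intro recursive_compose[OF a recursive_p1])
qed

lemma recursive_pred [recursive_intro]: "recursive a \<Longrightarrow> recursive (\<lambda>x. a x - 1)"
proof -
  have "rec_nat 0 (\<lambda>m _. m) n = n - 1" for n by (cases n) auto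
  then have *: "(\<lambda>x. a x - 1) = (\<lambda>x. rec_nat 0 (\<lambda>m _. m) (a x))" by simp
  assume "recursive a"
  then show ?thesis unfolding * by (intro recursive_intro)
qed

lemma recursive_minus [recursive_intro]: "recursive a \<Longrightarrow> recursive b \<Longrightarrow> recursive (\<lambda>x. a x - b x)"
proof -
  have "rec_nat m (\<lambda>_ r. r - 1) n = m - n" for m n by (induction n) auto
  then have *: "(\<lambda>x. a x - b x) = (\<lambda>x. rec_nat (a x) (\<lambda>_ r. r - 1) (b x))" by simp
  assume "recursive a" "recursive b"
  then show ?thesis unfolding * by (intro recursive_intro)
qed

lemma recursive_pred_le [recursive_intro]: "recursive a \<Longrightarrow> recursive b \<Longrightarrow> recursive_pred (\<lambda>x. a x \<le> b x)"
  using recursive_pred_eq0[OF recursive_minus, of a b] by simp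

lemma recursive_pred_less [recursive_intro]: "recursive a \<Longrightarrow> recursive b \<Longrightarrow> recursive_pred (\<lambda>x. a x < b x)"
  using recursive_pred_not[OF recursive_pred_le, of b a] by (simp add: not_le)

lemma recursive_pred_eq [recursive_intro]: "recursive a \<Longrightarrow> recursive b \<Longrightarrow> recursive_pred (\<lambda>x. a x = b x)"
  using recursive_pred_conj[OF recursive_pred_le recursive_pred_le, of a b b a] by (simp add: order_eq_iff)

text \<open>A counter that wraps around after \<open>2\<close>; the alphabet will have three
  letters.\<close>

lemma recursive_mod3 [recursive_intro]: "recursive a \<Longrightarrow> recursive (\<lambda>x. a x mod 3)"
proof -
  have "rec_nat 0 (\<lambda>_ r. if r = 2 then 0 else Suc r) n = n mod 3" for n :: nat
    by (induction n) (auto simp: mod_Suc)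
  then have *: "(\<lambda>x. a x mod 3) = (\<lambda>x. rec_nat 0 (\<lambda>_ r. if r = 2 then 0 else Suc r) (a x))" by simp
  assume "recursive a"
  then show ?thesis unfolding * by (intro recursive_intro)
qed

lemma recursive_pred_compose: "recursive_pred P \<Longrightarrow> recursive a \<Longrightarrow> recursive_pred (\<lambda>x. P (a x))"
  unfolding recursive_pred_def by (rule recursive_compose)

lemma recursive_pred_app2:
  assumes "recursive_pred (\<lambda>z. P (p1 z) (p2 z))" "recursive a" "recursive b"
  shows "recursive_pred (\<lambda>x. P (a x) (b x))"
  using recursive_pred_compose[OF assms(1) recursive_pr[OF assms(2,3)]] by simp

lemma recursive_pred_all_less [recursive_intro]:
  assumes "recursive b" "recursive_pred (\<lambda>z. P (p1 z) (p2 z))"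
  shows "recursive_pred (\<lambda>x. \<forall>i<b x. P x i)"
proof -
  have "rec_nat 1 (\<lambda>i r. if P x i then r else 0) n = (if \<forall>i<n. P x i then 1 else (0::nat))" for x n
    by (induction n) (auto simp: less_Suc_eq)
  then have *: "(\<lambda>x. if \<forall>i<b x. P x i then 1 else 0) =
    (\<lambda>x. rec_nat 1 (\<lambda>i r. if P x i then r else (0::nat)) (b x))" by simp
  show ?thesis unfolding recursive_pred_def *
    by (intro recursive_intro assms recursive_pred_app2[OF assms(2)])
qed

lemma recursive_pred_ex_less [recursive_intro]:
  assumes "recursive b" "recursive_pred (\<lambda>z. P (p1 z) (p2 z))"
  shows "recursive_pred (\<lambda>x. \<exists>i<b x. P x i)"
  using recursive_pred_not[OF recursive_pred_all_less[OF assms(1) recursive_pred_not[OF assms(2)]]] by simp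

text \<open>\<open>Mu\<close> searches for a zero, so it is applied to the characteristic function
  of the negation. That function is total, and the second assumption makes the search
  terminate.\<close>

lemma recursive_Least [recursive_intro]:
  assumes "recursive_pred (\<lambda>z. P (p1 z) (p2 z))" "\<And>x. \<exists>n. P x n"
  shows "recursive (\<lambda>x. LEAST n. P x n)"
proof -
  from recursive_pred_not[OF assms(1)] obtain c where
    c: "\<And>f z. run c f z = Some (if \<not> P (p1 z) (p2 z) then 1 else 0)"
    unfolding recursive_pred_def recursive_def by metis
  have c': "run c f (prod_encode (x, n)) = Some (if P x n then 0 else 1)" for f x n
    using c[of f "pr x n"] by (simp add: pr_def[symmetric])
  have "run (Mu c) f x = Some (LEAST n. P x n)" for f x
    using assms(2)[of x] by (auto simp: c' split: if_splits)
  then show ?thesis unfolding recursive_def by blast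
qed

lemma recursive_funpow:
  assumes "recursive g" "recursive n" "recursive a"
  shows "recursive (\<lambda>x. (g ^^ n x) (a x))"
proof -
  have "rec_nat y (\<lambda>_ r. g r) m = (g ^^ m) y" for m y by (induction m) auto
  then have *: "(\<lambda>x. (g ^^ n x) (a x)) = (\<lambda>x. rec_nat (a x) (\<lambda>_ r. g r) (n x))" by simp
  show ?thesis unfolding * by (intro recursive_intro assms recursive_compose[OF assms(1)])
qed

section \<open>Reading and building list codes\<close>

definition nth_code :: "nat \<Rightarrow> nat \<Rightarrow> nat" where
  "nth_code l j = p1 (((\<lambda>m. p2 (m - 1)) ^^ j) l - 1)"

text \<open>A nonempty list is coded by the successor of the pair of head and coded tail, so
  \<open>p2 (m - 1)\<close> drops the head. The code \<open>0\<close> of the empty list is fixed by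
  this, and reading past the end yields \<open>0\<close>, just as an ideal center continues with
  zeros.\<close>

lemma nth_code_list_encode: "nth_code (list_encode w) j = (if j < length w then w ! j else 0)"
proof -
  have "((\<lambda>m. p2 (m - 1)) ^^ j) (list_encode w) = list_encode (drop j w)"
  proof (induction j arbitrary: w)
    case (Suc j)
    have "p2 (list_encode w - 1) = list_encode (tl w)"
      by (cases w) (simp_all add: p2_def[of "prod_encode _"])
    then show ?case
      using Suc[of "tl w"] by (simp add: funpow_Suc_right drop_Suc del: funpow.simps)
  qed simp
  then show ?thesis
    by (cases "drop j w")
      (auto simp: nth_code_def p1_def[of "prod_encode _"] nth_via_drop)
qed

lemma recursive_nth_code [recursive_intro]: "recursive l \<Longrightarrow> recursive j \<Longrightarrow> recursive (\<lambda>x. nth_code (l x) (j x))"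
proof -
  have *: "recursive (\<lambda>m. p2 (m - 1))" by (intro recursive_intro)
  assume "recursive l" "recursive j"
  then show ?thesis unfolding nth_code_def by (intro recursive_intro recursive_funpow[OF *])
qed

lemma recursive_list_encode_map [recursive_intro]:
  assumes "recursive (\<lambda>z. F (p1 z) (p2 z))" "recursive n"
  shows "recursive (\<lambda>x. list_encode (map (F x) [0..<n x]))"
proof -
  \<comment> \<open>The code grows at the head, so the list is built from its end: round
    \<open>i\<close> holds the last \<open>i\<close> entries.\<close>
  have "rec_nat 0 (\<lambda>i r. Suc (pr (F x (m - Suc i)) r)) i = list_encode (map (F x) [m - i..<m])"
    if "i \<le> m" for x m i
    using that
  proof (induction i)
    case (Suc i)
    then have "[m - Suc i..<m] = (m - Suc i) # [m - i..<m]"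
      by (metis Suc_diff_Suc Suc_le_lessD diff_less upt_conv_Cons zero_less_Suc less_le_trans)
    then show ?case using Suc by (simp add: pr_def)
  qed simp
  from this[OF order.refl] have *: "(\<lambda>x. list_encode (map (F x) [0..<n x])) =
     (\<lambda>x. rec_nat 0 (\<lambda>i r. Suc (pr (F x (n x - Suc i)) r)) (n x))" by simp
  show ?thesis unfolding *
    by (intro recursive_intro assms recursive_app2[OF assms(1)] recursive_compose[OF assms(2)])
qed

section \<open>A universal machine\<close>

text \<open>
  A state is \<open>pr m (pr b K)\<close>: if \<open>m\<close> codes a program, that program is about to be run on \<open>b\<close>; if
  \<open>p1 m = 0\<close>, the value \<open>b\<close> is returned to the stack of continuations \<open>K\<close> (\<open>0\<close> is the empty stack).
\<close>

primrec enc :: "program \<Rightarrow> nat" where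
  "enc Zero = pr 1 0"
| "enc Succ = pr 2 0"
| "enc Fst = pr 3 0"
| "enc Snd = pr 4 0"
| "enc (Pairing c d) = pr 5 (pr (enc c) (enc d))"
| "enc (Comp c d) = pr 6 (pr (enc c) (enc d))"
| "enc (Prec c d) = pr 7 (pr (enc c) (enc d))"
| "enc (Mu c) = pr 8 (enc c)"
| "enc Oracle = pr 9 0"

definition ret :: "nat \<Rightarrow> nat \<Rightarrow> nat" where "ret v K = pr 0 (pr v K)"
definition evl :: "nat \<Rightarrow> nat \<Rightarrow> nat \<Rightarrow> nat" where "evl m x K = pr m (pr x K)"
definition frame :: "nat \<Rightarrow> nat \<Rightarrow> nat \<Rightarrow> nat" where "frame t a K = pr t (pr a K)"

text \<open>The tags \<open>1\<close> and \<open>9\<close> share the last case: the simulated oracle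
  is the zero function.\<close>

definition start :: "nat \<Rightarrow> nat \<Rightarrow> nat \<Rightarrow> nat \<Rightarrow> nat" where
  "start t a x K =
    (if t = 2 then ret (Suc x) K
     else if t = 3 then ret (p1 x) K
     else if t = 4 then ret (p2 x) K
     else if t = 5 then evl (p1 a) x (frame 1 (pr (p2 a) x) K)
     else if t = 6 then evl (p2 a) x (frame 3 (p1 a) K)
     else if t = 7 then evl (p1 a) (p1 x) (frame 4 (pr (p2 a) (pr (p1 x) (pr 0 (p2 x)))) K)
     else if t = 8 then evl a (pr x 0) (frame 5 (pr a (pr x 0)) K)
     else ret 0 K)"

text \<open>Frame contents by tag: \<open>1\<close> the second program of a pairing and its input;
  \<open>2\<close> the first value of a pairing; \<open>3\<close> the outer program of a
  composition; \<open>4\<close> the step program of a recursion with parameter, counter and bound;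
  \<open>5\<close> the program of a search with its input and current candidate. Tag
  \<open>0\<close> means the empty stack, where the state stays as it is.\<close>

definition resume :: "nat \<Rightarrow> nat \<Rightarrow> nat \<Rightarrow> nat \<Rightarrow> nat" where
  "resume t a v K =
    (if t = 0 then ret v 0
     else if t = 1 then evl (p1 a) (p2 a) (frame 2 v K)
     else if t = 2 then ret (pr a v) K
     else if t = 3 then evl a v K
     else if t = 4 then
       (if p1 (p2 (p2 a)) = p2 (p2 (p2 a)) then ret v K
        else evl (p1 a) (pr (p1 (p2 a)) (pr (p1 (p2 (p2 a))) v))
          (frame 4 (pr (p1 a) (pr (p1 (p2 a)) (pr (Suc (p1 (p2 (p2 a)))) (p2 (p2 (p2 a)))))) K))
     else
       (if v = 0 then ret (p2 (p2 a)) K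
        else evl (p1 a) (pr (p1 (p2 a)) (Suc (p2 (p2 a))))
          (frame 5 (pr (p1 a) (pr (p1 (p2 a)) (Suc (p2 (p2 a))))) K)))"

definition step :: "nat \<Rightarrow> nat" where
  "step s =
    (let m = p1 s; b = p1 (p2 s); K = p2 (p2 s) in
     if p1 m = 0 then resume (p1 K) (p1 (p2 K)) b (p2 (p2 K)) else start (p1 m) (p2 m) b K)"

lemma recursive_step: "recursive step"
  unfolding step_def Let_def resume_def start_def ret_def evl_def frame_def
  by (intro recursive_intro)

lemma step_ret: "step (ret v (frame t a K)) = resume t a v K"
  by (simp add: step_def ret_def frame_def)

lemma step_ret_0: "step (ret v 0) = ret v 0"
  by (simp add: step_def ret_def resume_def)

lemma step_evl: "t \<noteq> 0 \<Longrightarrow> step (evl (pr t a) x K) = start t a x K"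
  by (simp add: step_def evl_def)

definition reaches :: "nat \<Rightarrow> nat \<Rightarrow> bool" where
  "reaches s s' \<longleftrightarrow> (\<exists>n. (step ^^ n) s = s')"

lemma reaches_refl [simp]: "reaches s s"
  unfolding reaches_def by (metis funpow_0)

lemma reaches_trans [trans]: "reaches s s' \<Longrightarrow> reaches s' s'' \<Longrightarrow> reaches s s''"
  unfolding reaches_def by (metis funpow_add o_apply)

lemma reaches_step: "reaches (step s) s' \<Longrightarrow> reaches s s'"
  unfolding reaches_def by (metis funpow_Suc_right o_apply)

text \<open>Induction on the program with an arbitrary stack: each subprogram runs with the frame
  that awaits its value pushed on top.\<close>

lemma run_reaches: "run c (\<lambda>_. 0) x = Some v \<Longrightarrow> reaches (evl (enc c) x K) (ret v K)"
proof (induction c arbitrary: x v K)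
  case (Pairing c d)
  then obtain a b where ab: "run c (\<lambda>_. 0) x = Some a" "run d (\<lambda>_. 0) x = Some b" "v = pr a b"
    by (auto simp: bind_eq_Some_conv pr_def)
  have "reaches (evl (enc c) x (frame 1 (pr (enc d) x) K)) (ret a (frame 1 (pr (enc d) x) K))"
    using Pairing ab by blast
  also have "reaches \<dots> (ret b (frame 2 a K))"
    by (rule reaches_step) (use Pairing ab in \<open>simp add: step_ret resume_def\<close>)
  also have "reaches \<dots> (ret v K)"
    by (rule reaches_step) (use ab in \<open>simp add: step_ret resume_def\<close>)
  finally show ?case by (intro reaches_step[of "evl _ _ _"]) (simp add: step_evl start_def)
next
  case (Comp c d)
  then obtain a where a: "run d (\<lambda>_. 0) x = Some a" "run c (\<lambda>_. 0) a = Some v"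
    by (auto simp: bind_eq_Some_conv)
  have "reaches (evl (enc d) x (frame 3 (enc c) K)) (ret a (frame 3 (enc c) K))"
    using Comp a by blast
  also have "reaches \<dots> (ret v K)"
    by (rule reaches_step) (use Comp a in \<open>simp add: step_ret resume_def\<close>)
  finally show ?case by (intro reaches_step[of "evl _ _ _"]) (simp add: step_evl start_def)
next
  case (Prec c d)
  \<comment> \<open>\<open>R k\<close> is the value of the recursion after \<open>k\<close> rounds,
    and \<open>fr k\<close> is the frame that waits for it.\<close>
  define R where "R k = rec_nat (run c (\<lambda>_. 0) (p1 x))
       (\<lambda>m r. Option.bind r (\<lambda>v. run d (\<lambda>_. 0) (pr (p1 x) (pr m v)))) k" for k
  define fr where "fr k = frame 4 (pr (enc d) (pr (p1 x) (pr k (p2 x)))) K" for k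
  have R: "R (p2 x) = Some v" using Prec.prems by (simp add: R_def p1_def p2_def pr_def)
  have "reaches (evl (enc c) (p1 x) (fr 0)) (ret w (fr k))" if "R k = Some w" "k \<le> p2 x" for k w
    using that
  proof (induction k arbitrary: w)
    case 0
    then show ?case using Prec.IH by (simp add: R_def)
  next
    case (Suc k)
    then obtain u where u: "R k = Some u" "run d (\<lambda>_. 0) (pr (p1 x) (pr k u)) = Some w"
      by (auto simp: R_def bind_eq_Some_conv)
    have "reaches (evl (enc c) (p1 x) (fr 0)) (ret u (fr k))" using Suc u by simp
    also have "reaches (ret u (fr k)) (ret w (fr (Suc k)))"
      by (rule reaches_step)
         (use Suc.prems Prec.IH(2)[OF u(2)] in \<open>simp add: step_ret resume_def fr_def\<close>)
    finally show ?case .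
  qed
  from this[OF R] have "reaches (evl (enc c) (p1 x) (fr 0)) (ret v (fr (p2 x)))" by simp
  also have "reaches \<dots> (ret v K)"
    by (rule reaches_step) (simp add: step_ret resume_def fr_def)
  finally show ?case by (intro reaches_step[of "evl _ _ _"]) (simp add: step_evl start_def fr_def)
next
  case (Mu c)
  define fr where "fr k = frame 5 (pr (enc c) (pr x k)) K" for k
  from Mu.prems obtain n where n: "run c (\<lambda>_. 0) (pr x n) = Some 0"
      "\<And>m. m < n \<Longrightarrow> run c (\<lambda>_. 0) (pr x m) \<noteq> None"
    and v: "v = (LEAST n. run c (\<lambda>_. 0) (pr x n) = Some 0)"
    by (auto simp: pr_def split: if_splits)
  have v0: "run c (\<lambda>_. 0) (pr x v) = Some 0" unfolding v using n(1) by (rule LeastI)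
  have "v \<le> n" unfolding v using n(1) by (rule Least_le)
  \<comment> \<open>Every candidate below the least zero is answered by a nonzero value, after which
    the frame passes to the next candidate.\<close>
  have less: "\<exists>w. run c (\<lambda>_. 0) (pr x m) = Some (Suc w)" if "m < v" for m
  proof -
    have "run c (\<lambda>_. 0) (pr x m) \<noteq> Some 0" using that not_less_Least unfolding v by blast
    moreover have "run c (\<lambda>_. 0) (pr x m) \<noteq> None" using n(2) that \<open>v \<le> n\<close> by simp
    ultimately show ?thesis using not0_implies_Suc by fastforce
  qed
  have "reaches (evl (enc c) (pr x 0) (fr 0)) (evl (enc c) (pr x m) (fr m))" if "m \<le> v" for m
    using that
  proof (induction m)
    case (Suc m)
    then obtain w where w: "run c (\<lambda>_. 0) (pr x m) = Some (Suc w)" using less[of m] by auto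
    have "reaches (evl (enc c) (pr x 0) (fr 0)) (evl (enc c) (pr x m) (fr m))" using Suc by simp
    also have "reaches \<dots> (ret (Suc w) (fr m))" using Mu.IH[OF w] .
    also have "reaches \<dots> (evl (enc c) (pr x (Suc m)) (fr (Suc m)))"
      by (rule reaches_step) (simp add: step_ret resume_def fr_def)
    finally show ?case .
  qed simp
  from this[of v] have "reaches (evl (enc c) (pr x 0) (fr 0)) (evl (enc c) (pr x v) (fr v))" by simp
  also have "reaches \<dots> (ret 0 (fr v))" using Mu.IH[OF v0] .
  also have "reaches \<dots> (ret v K)"
    by (rule reaches_step) (simp add: step_ret resume_def fr_def)
  finally show ?case by (intro reaches_step[of "evl _ _ _"]) (simp add: step_evl start_def fr_def)
qed (rule reaches_step, simp add: step_evl start_def p1_def p2_def)+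

text \<open>A state \<open>ret w 0\<close> is fixed by \<open>step\<close>, so two such states on
  one computation coincide. The output of a halting program thus becomes the existence of a number
  of steps, with a decidable condition on that number.\<close>

lemma run_Some_iff:
  assumes "run c (\<lambda>_. 0) x = Some v"
  shows "v = w \<longleftrightarrow> (\<exists>n. (step ^^ n) (evl (enc c) x 0) = ret w 0)"
proof -
  have fix_pt: "(step ^^ n) (ret w 0) = ret w 0" for n w
    by (induction n) (auto simp: step_ret_0)
  obtain m where m: "(step ^^ m) (evl (enc c) x 0) = ret v 0"
    using run_reaches[OF assms, of 0] unfolding reaches_def by blast
  have "v = w" if "(step ^^ n) (evl (enc c) x 0) = ret w 0" for n
  proof -
    have "(step ^^ (n + m)) (evl (enc c) x 0) = ret v 0"
      by (simp add: funpow_add m fix_pt)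
    moreover have "(step ^^ (m + n)) (evl (enc c) x 0) = ret w 0"
      by (simp add: funpow_add that fix_pt)
    ultimately show ?thesis by (simp add: add.commute ret_def)
  qed
  then show ?thesis using m by blast
qed

text \<open>
  \<open>wit (Suc (pr p x)) y w\<close> says that the program with code \<open>p\<close> rejects \<open>((x, y), p1 w)\<close> within
  \<open>p2 w\<close> steps. The code \<open>0\<close> is reserved for an element of \<open>univ_Pi2\<close>.
\<close>

definition wit :: "nat \<Rightarrow> nat \<Rightarrow> nat \<Rightarrow> bool" where
  "wit c y w \<longleftrightarrow> c = 0 \<or>
     (step ^^ p2 w) (evl (p1 (c - 1)) (pr (pr (p2 (c - 1)) y) (p1 w)) 0) = ret 0 0"

definition univ_Pi2 :: "nat set" where
  "univ_Pi2 = {c. \<forall>y. \<exists>w. wit c y w}"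

lemma recursive_pred_wit [recursive_intro]:
  "recursive a \<Longrightarrow> recursive b \<Longrightarrow> recursive c \<Longrightarrow> recursive_pred (\<lambda>x. wit (a x) (b x) (c x))"
  unfolding wit_def ret_def evl_def by (intro recursive_intro recursive_funpow[OF recursive_step])

lemma zero_in_univ_Pi2: "0 \<in> univ_Pi2"
  by (simp add: univ_Pi2_def wit_def)

text \<open>Unfolded, \<open>x \<in> A\<close> says that some \<open>y\<close> has no
  \<open>t\<close> with \<open>((x, y), t)\<close> in \<open>C\<close>. The program decides
  \<open>- C\<close>, so its answer \<open>0\<close> signals membership in \<open>C\<close>; a
  witness in \<open>wit\<close> packs \<open>t\<close> together with a running time.\<close>

lemma univ_Pi2_universal:
  assumes "arith_sigma 2 A"
  shows "\<exists>p. \<forall>x. x \<in> A \<longleftrightarrow> Suc (pr p x) \<notin> univ_Pi2"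
proof -
  from assms obtain B C where A: "A = {x. \<exists>y. prod_encode (x, y) \<in> B}"
    and B: "- B = {x. \<exists>t. prod_encode (x, t) \<in> C}" and C: "decidable (- C)"
    by (auto simp: numeral_2_eq_2)
  from C obtain p where p: "\<And>u. run p (\<lambda>_. 0) u = Some (if u \<in> - C then 1 else 0)"
    unfolding decidable_def computable_fun_def by blast
  have "u \<in> C \<longleftrightarrow> (\<exists>n. (step ^^ n) (evl (enc p) u 0) = ret 0 0)" for u
    using run_Some_iff[OF p[of u], of 0] by (simp split: if_splits)
  then have w: "(\<exists>w. wit (Suc (pr (enc p) x)) y w) \<longleftrightarrow> (\<exists>t. pr (pr x y) t \<in> C)" for x y
    unfolding wit_def by simp (metis p1_pr p2_pr)
  have "x \<in> A \<longleftrightarrow> Suc (pr (enc p) x) \<notin> univ_Pi2" for x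
  proof -
    have "x \<in> A \<longleftrightarrow> (\<exists>y. \<not> (\<exists>t. pr (pr x y) t \<in> C))"
      using B unfolding A pr_def by blast
    then show ?thesis unfolding univ_Pi2_def by (simp add: w del: not_ex)
  qed
  then show ?thesis by blast
qed

text \<open>
  The numbers \<open>pr c (pr m n)\<close> at which \<open>c\<close> is listed: \<open>n\<close> is least such that all \<open>y < m\<close> have
  witnesses below \<open>n\<close>. So \<open>m\<close> determines \<open>n\<close>, and \<open>c\<close> is listed infinitely often iff every \<open>m\<close>
  occurs.
\<close>

definition wits :: "nat \<Rightarrow> nat \<Rightarrow> nat \<Rightarrow> bool" where
  "wits c m n \<longleftrightarrow> (\<forall>y<m. \<exists>w<n. wit c y w)"

definition list_Pi2 :: "nat \<Rightarrow> nat" where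
  "list_Pi2 k =
    (if wits (p1 k) (p1 (p2 k)) (p2 (p2 k)) \<and>
        \<not> (0 < p2 (p2 k) \<and> wits (p1 k) (p1 (p2 k)) (p2 (p2 k) - 1))
     then p1 k else 0)"

lemma recursive_list_Pi2: "recursive list_Pi2"
  unfolding list_Pi2_def wits_def by (intro recursive_intro)

lemma wits_mono: "wits c m n \<Longrightarrow> m' \<le> m \<Longrightarrow> n \<le> n' \<Longrightarrow> wits c m' n'"
  unfolding wits_def by (meson less_le_trans)

lemma list_Pi2_pr:
  "list_Pi2 (pr c (pr m n)) = (if wits c m n \<and> (\<forall>n'<n. \<not> wits c m n') then c else 0)"
proof -
  have "(0 < n \<and> wits c m (n - 1)) \<longleftrightarrow> (\<exists>n'<n. wits c m n')"
  proof
    assume "0 < n \<and> wits c m (n - 1)"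
    then show "\<exists>n'<n. wits c m n'" by (intro exI[of _ "n - 1"]) simp
  next
    assume "\<exists>n'<n. wits c m n'"
    then obtain n' where "n' < n" "wits c m n'" by blast
    then show "0 < n \<and> wits c m (n - 1)" using wits_mono[of c m n' m "n - 1"] by simp
  qed
  then show ?thesis by (auto simp: list_Pi2_def)
qed

text \<open>For \<open>c \<noteq> 0\<close> each \<open>m\<close> contributes at most one position,
  so infinitely many positions mean arbitrarily large \<open>m\<close>, hence all \<open>m\<close>
  by \<open>wits_mono\<close>. The number \<open>0\<close> is also the default output of
  \<open>list_Pi2\<close>, which is why it was made an element of \<open>univ_Pi2\<close>.\<close>

lemma infinite_list_Pi2: "(\<exists>\<^sub>\<infinity>k. list_Pi2 k = c) \<longleftrightarrow> c \<in> univ_Pi2"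
proof (cases "c = 0")
  case True
  have "(\<exists>\<^sub>\<infinity>k. list_Pi2 k = 0)"
  proof -
    have "list_Pi2 (pr 0 (pr 0 (Suc n))) = 0" for n by (simp add: list_Pi2_pr)
    moreover have "inj (\<lambda>n. pr 0 (pr 0 (Suc n)))" by (auto simp: inj_on_def)
    ultimately show ?thesis unfolding INFM_iff_infinite
      by (intro infinite_super[OF _ range_inj_infinite]) auto
  qed
  then show ?thesis using True zero_in_univ_Pi2 by simp
next
  case c: False
  define E where "E = {k. list_Pi2 k = c}"
  have E: "pr c' (pr m n) \<in> E \<longleftrightarrow> c' = c \<and> wits c m n \<and> (\<forall>n'<n. \<not> wits c m n')" for c' m n
    using c by (auto simp: E_def list_Pi2_pr)
  have inj: "inj_on (\<lambda>k. p1 (p2 k)) E"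
  proof (rule inj_onI)
    fix k l assume *: "k \<in> E" "l \<in> E" "p1 (p2 k) = p1 (p2 l)"
    have k: "k = pr (p1 k) (pr (p1 (p2 k)) (p2 (p2 k)))" "l = pr (p1 l) (pr (p1 (p2 l)) (p2 (p2 l)))"
      by simp_all
    have "p2 (p2 k) = p2 (p2 l)" "p1 k = p1 l" using * E k by (metis linorder_neqE_nat)+
    then show "k = l" using k * by metis
  qed
  have "infinite E \<longleftrightarrow> (\<forall>m. \<exists>n. wits c m n)"
  proof
    assume "infinite E"
    then have "infinite ((\<lambda>k. p1 (p2 k)) ` E)" using inj finite_image_iff by blast
    then show "\<forall>m. \<exists>n. wits c m n"
    proof (intro allI)
      fix m assume "infinite ((\<lambda>k. p1 (p2 k)) ` E)"
      then obtain k where "k \<in> E" "m \<le> p1 (p2 k)"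
        by (metis (no_types, lifting) imageE infinite_nat_iff_unbounded_le)
      then have "wits c (p1 (p2 k)) (p2 (p2 k))" by (metis E pr_p1_p2)
      then show "\<exists>n. wits c m n" using wits_mono \<open>m \<le> _\<close> by blast
    qed
  next
    assume all: "\<forall>m. \<exists>n. wits c m n"
    have "pr c (pr m (LEAST n. wits c m n)) \<in> E" for m
      unfolding E using all LeastI_ex[of "wits c m"] not_less_Least by blast
    moreover have "inj (\<lambda>m. pr c (pr m (LEAST n. wits c m n)))" by (auto simp: inj_on_def)
    ultimately show "infinite E"
      by (intro infinite_super[OF _ range_inj_infinite]) auto
  qed
  also have "\<dots> \<longleftrightarrow> c \<in> univ_Pi2"
  proof
    show "\<forall>m. \<exists>n. wits c m n \<Longrightarrow> c \<in> univ_Pi2"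
      unfolding wits_def univ_Pi2_def by blast
    assume "c \<in> univ_Pi2"
    then have ex: "\<exists>w. wit c y w" for y by (auto simp: univ_Pi2_def)
    show "\<forall>m. \<exists>n. wits c m n"
    proof
      show "\<exists>n. wits c m n" for m
      proof (induction m)
        case (Suc m)
        then obtain n w where "wits c m n" "wit c m w" using ex by blast
        then have "wits c (Suc m) (max n (Suc w))"
          unfolding wits_def by (metis less_Suc_eq less_max_iff_disj)
        then show ?case ..
      qed (simp add: wits_def)
    qed
  qed
  finally show ?thesis by (simp add: E_def INFM_iff_infinite)
qed

section \<open>Topology and measure on symbolic spaces\<close>

definition agree :: "nat \<Rightarrow> (nat \<Rightarrow> nat) \<Rightarrow> (nat \<Rightarrow> nat) \<Rightarrow> bool" where
  "agree n x y \<longleftrightarrow> (\<forall>i<n. x i = y i)"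

lemma agree_refl [simp]: "agree n x x"
  by (simp add: agree_def)

lemma agree_sym: "agree n x y \<Longrightarrow> agree n y x"
  by (simp add: agree_def)

lemma agree_trans: "agree n x y \<Longrightarrow> agree n y z \<Longrightarrow> agree n x z"
  by (simp add: agree_def)

lemma agree_mono: "agree n x y \<Longrightarrow> m \<le> n \<Longrightarrow> agree m x y"
  by (simp add: agree_def)

lemma symb_dist_neqE:
  assumes "x \<noteq> y"
  obtains m where "symb_dist x y = (1 / 2) ^ m" "\<And>n. agree n x y \<longleftrightarrow> n \<le> m"
proof -
  define m where "m = (LEAST n. x n \<noteq> y n)"
  have "\<exists>n. x n \<noteq> y n" using assms by auto
  then have "x m \<noteq> y m" "\<And>i. i < m \<Longrightarrow> x i = y i"
    unfolding m_def using LeastI_ex[of "\<lambda>n. x n \<noteq> y n"] not_less_Least by blast+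
  then have "agree n x y \<longleftrightarrow> n \<le> m" for n
    unfolding agree_def by (meson le_less_linear order_less_le_trans)
  then show ?thesis using that[of m] assms by (simp add: symb_dist_def m_def)
qed

text \<open>Nonzero distances are powers of \<open>1 / 2\<close>, so every ball is a cylinder; its
  length is the first exponent at which the power drops below the radius.\<close>

lemma symb_dist_less_Least_iff:
  assumes "0 < r"
  shows "symb_dist x y < r \<longleftrightarrow> agree (LEAST n. (1 / 2) ^ n < r) x y"
proof (cases "x = y")
  case False
  then obtain m where m: "symb_dist x y = (1 / 2) ^ m" "\<And>n. agree n x y \<longleftrightarrow> n \<le> m"
    using symb_dist_neqE by blast
  have ex: "\<exists>n. (1 / 2) ^ n < r" using assms real_arch_pow_inv[of r "1 / 2"] by auto
  have "(1 / 2) ^ m < r \<longleftrightarrow> (LEAST n. (1 / 2) ^ n < r) \<le> m"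
  proof
    assume "(LEAST n. (1 / 2) ^ n < r) \<le> m"
    then have "((1 / 2) ^ m :: real) \<le> (1 / 2) ^ (LEAST n. (1 / 2) ^ n < r)"
      by (intro power_decreasing) auto
    also have "\<dots> < r" using LeastI_ex[OF ex] .
    finally show "(1 / 2) ^ m < r" .
  qed (rule Least_le)
  then show ?thesis using m by simp
qed (use assms in \<open>simp add: symb_dist_def\<close>)

lemma symb_dist_le_Least_iff:
  assumes "0 < r"
  shows "symb_dist x y \<le> r \<longleftrightarrow> agree (LEAST n. (1 / 2) ^ n \<le> r) x y"
proof (cases "x = y")
  case False
  then obtain m where m: "symb_dist x y = (1 / 2) ^ m" "\<And>n. agree n x y \<longleftrightarrow> n \<le> m"
    using symb_dist_neqE by blast
  have ex: "\<exists>n. (1 / 2) ^ n \<le> r"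
    using assms real_arch_pow_inv[of r "1 / 2"] less_imp_le by auto
  have "(1 / 2) ^ m \<le> r \<longleftrightarrow> (LEAST n. (1 / 2) ^ n \<le> r) \<le> m"
  proof
    assume "(LEAST n. (1 / 2) ^ n \<le> r) \<le> m"
    then have "((1 / 2) ^ m :: real) \<le> (1 / 2) ^ (LEAST n. (1 / 2) ^ n \<le> r)"
      by (intro power_decreasing) auto
    also have "\<dots> \<le> r" using LeastI_ex[OF ex] .
    finally show "(1 / 2) ^ m \<le> r" .
  qed (rule Least_le)
  then show ?thesis using m by simp
qed (use assms in \<open>simp add: symb_dist_def\<close>)

section \<open>Ideal balls as cylinders of computable length\<close>

definition ball_length :: "nat \<Rightarrow> nat" where
  "ball_length i = (LEAST n. Suc (p2 (p2 i)) < Suc (p1 (p2 i)) * 2 ^ n)"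

definition cball_length :: "nat \<Rightarrow> nat" where
  "cball_length i = (LEAST n. Suc (p2 (p2 i)) \<le> Suc (p1 (p2 i)) * 2 ^ n)"

lemma ideal_radius_eq: "ideal_radius i = real (Suc (p1 (p2 i))) / real (Suc (p2 (p2 i)))"
  by (simp add: ideal_radius_def p1_def p2_def split_beta)

lemma ideal_radius_pos: "0 < ideal_radius i"
  by (simp add: ideal_radius_eq)

text \<open>Clearing denominators turns the comparison of \<open>(1 / 2) ^ n\<close> with the
  rational radius into one between natural numbers, which can be searched by a program.\<close>

lemma ball_length_eq: "ball_length i = (LEAST n. (1 / 2) ^ n < ideal_radius i)"
proof -
  have "(1 / 2) ^ n < ideal_radius i \<longleftrightarrow> Suc (p2 (p2 i)) < Suc (p1 (p2 i)) * 2 ^ n" for n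
  proof -
    have "(1 / 2) ^ n < ideal_radius i \<longleftrightarrow>
      real (Suc (p2 (p2 i))) < real (Suc (p1 (p2 i)) * 2 ^ n)"
      unfolding ideal_radius_eq of_nat_mult by (simp add: power_divide divide_simps del: of_nat_Suc)
    then show ?thesis unfolding of_nat_less_iff .
  qed
  then show ?thesis by (simp add: ball_length_def)
qed

lemma cball_length_eq: "cball_length i = (LEAST n. (1 / 2) ^ n \<le> ideal_radius i)"
proof -
  have "(1 / 2) ^ n \<le> ideal_radius i \<longleftrightarrow> Suc (p2 (p2 i)) \<le> Suc (p1 (p2 i)) * 2 ^ n" for n
  proof -
    have "(1 / 2) ^ n \<le> ideal_radius i \<longleftrightarrow>
      real (Suc (p2 (p2 i))) \<le> real (Suc (p1 (p2 i)) * 2 ^ n)"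
      unfolding ideal_radius_eq of_nat_mult by (simp add: power_divide divide_simps del: of_nat_Suc)
    then show ?thesis unfolding of_nat_le_iff .
  qed
  then show ?thesis by (simp add: cball_length_def)
qed

text \<open>The coded radius is \<open>1 / (2 ^ n + 1)\<close>, smaller than
  \<open>(1 / 2) ^ n\<close>. Such indices provide balls that fix more than \<open>n\<close> letters
  around any coded word.\<close>

lemma ball_length_gt: "n < ball_length (pr w (pr 0 (2 ^ n)))"
proof -
  have "0 < (2::nat) ^ n" by simp
  then have "Suc (2 ^ n) < (2::nat) ^ Suc (Suc n)" unfolding power_Suc by linarith
  then have "Suc (2 ^ n) < (2::nat) ^ ball_length (pr w (pr 0 (2 ^ n)))"
    unfolding ball_length_def by (simp, rule LeastI)
  then have "(2::nat) ^ n < 2 ^ ball_length (pr w (pr 0 (2 ^ n)))" by (rule Suc_lessD)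
  then show ?thesis by (rule power_less_imp_less_exp[rotated]) simp
qed

lemma cball_length_gt: "n < cball_length (pr w (pr 0 (2 ^ n)))"
proof -
  have "Suc (2 ^ n) \<le> (2::nat) ^ Suc n" using one_le_power[of "2::nat" n] by simp
  then have "Suc (2 ^ n) \<le> (2::nat) ^ cball_length (pr w (pr 0 (2 ^ n)))"
    unfolding cball_length_def by (simp del: power_Suc, rule LeastI)
  then have "(2::nat) ^ n < 2 ^ cball_length (pr w (pr 0 (2 ^ n)))" by (rule Suc_le_lessD)
  then show ?thesis by (rule power_less_imp_less_exp[rotated]) simp
qed

lemma recursive_ball_length [recursive_intro]:
  "recursive a \<Longrightarrow> recursive (\<lambda>x. ball_length (a x))"
proof -
  have "\<exists>n. Suc (p2 (p2 i)) < Suc (p1 (p2 i)) * 2 ^ n" for i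
    by (rule exI[of _ "Suc (p2 (p2 i))"]) (rule less_le_trans[OF less_exp], simp)
  then have "recursive ball_length"
    unfolding ball_length_def by (intro recursive_intro)
  then show "recursive a \<Longrightarrow> recursive (\<lambda>x. ball_length (a x))" by (rule recursive_compose)
qed

lemma recursive_cball_length [recursive_intro]:
  "recursive a \<Longrightarrow> recursive (\<lambda>x. cball_length (a x))"
proof -
  have "\<exists>n. Suc (p2 (p2 i)) \<le> Suc (p1 (p2 i)) * 2 ^ n" for i
    by (rule exI[of _ "Suc (p2 (p2 i))"])
      (rule less_imp_le, rule less_le_trans[OF less_exp], simp)
  then have "recursive cball_length"
    unfolding cball_length_def by (intro recursive_intro)
  then show "recursive a \<Longrightarrow> recursive (\<lambda>x. cball_length (a x))" by (rule recursive_compose)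
qed

lemma ideal_center_eq: "ideal_center k i n = nth_code (p1 i) n mod k"
proof -
  have "p1 i = list_encode (list_decode (p1 i))" by simp
  then have "nth_code (p1 i) n =
    (if n < length (list_decode (p1 i)) then list_decode (p1 i) ! n else 0)"
    using nth_code_list_encode by metis
  then show ?thesis by (simp add: ideal_center_def p1_def Let_def)
qed

lemma ideal_center_in_symb: "0 < k \<Longrightarrow> ideal_center k i \<in> symb k"
  by (simp add: symb_def ideal_center_eq)

lemma in_ideal_ball_iff:
  assumes "0 < k"
  shows "y \<in> ideal_ball k i \<longleftrightarrow> y \<in> symb k \<and> agree (ball_length i) (ideal_center k i) y"
  using ideal_center_in_symb[OF assms]
  by (simp add: ideal_ball_def Metric_space.in_mball[OF Metric_space_symb] ball_length_eq
      symb_dist_less_Least_iff ideal_radius_pos)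

lemma in_ideal_cball_iff:
  assumes "0 < k"
  shows "y \<in> ideal_cball k i \<longleftrightarrow> y \<in> symb k \<and> agree (cball_length i) (ideal_center k i) y"
  using ideal_center_in_symb[OF assms]
  by (simp add: ideal_cball_def Metric_space.in_mcball[OF Metric_space_symb] cball_length_eq
      symb_dist_le_Least_iff ideal_radius_pos)

lemma topspace_symb [simp]: "topspace (symb_top k) = symb k"
  by (rule Metric_space.topspace_mtopology[OF Metric_space_symb])

text \<open>Cylinders form a base, so later arguments can use \<open>agree\<close> in place of the
  metric.\<close>

lemma openin_symb_iff:
  "openin (symb_top k) U \<longleftrightarrow>
     U \<subseteq> symb k \<and> (\<forall>x\<in>U. \<exists>n. \<forall>y\<in>symb k. agree n x y \<longrightarrow> y \<in> U)"
proof -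
  have "(\<exists>r>0. Metric_space.mball (symb k) symb_dist x r \<subseteq> U) \<longleftrightarrow>
      (\<exists>n. \<forall>y\<in>symb k. agree n x y \<longrightarrow> y \<in> U)" if "x \<in> symb k" for x
  proof
    assume "\<exists>r>0. Metric_space.mball (symb k) symb_dist x r \<subseteq> U"
    then obtain r where "0 < r" "Metric_space.mball (symb k) symb_dist x r \<subseteq> U" by blast
    then show "\<exists>n. \<forall>y\<in>symb k. agree n x y \<longrightarrow> y \<in> U"
      using that symb_dist_less_Least_iff[OF \<open>0 < r\<close>]
      by (auto simp: subset_iff Metric_space.in_mball[OF Metric_space_symb])
  next
    assume "\<exists>n. \<forall>y\<in>symb k. agree n x y \<longrightarrow> y \<in> U"
    then obtain n where n: "\<forall>y\<in>symb k. agree n x y \<longrightarrow> y \<in> U" ..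
    have "Metric_space.mball (symb k) symb_dist x ((1 / 2) ^ n) \<subseteq> U"
      using n by (auto simp: Metric_space.in_mball[OF Metric_space_symb] symb_dist_less_iff agree_def)
    then show "\<exists>r>0. Metric_space.mball (symb k) symb_dist x r \<subseteq> U"
      by (intro exI[of _ "(1 / 2) ^ n"]) simp
  qed
  then show ?thesis
    unfolding Metric_space.openin_mtopology[OF Metric_space_symb] by blast
qed

lemma openin_symb_agree: "openin (symb_top k) {y \<in> symb k. agree n x y}"
  unfolding openin_symb_iff using agree_trans by blast

lemma closedin_symb_iff:
  "closedin (symb_top k) A \<longleftrightarrow>
     A \<subseteq> symb k \<and> (\<forall>x\<in>symb k. (\<forall>n. \<exists>a\<in>A. agree n x a) \<longrightarrow> x \<in> A)"
  unfolding closedin_def openin_symb_iff topspace_symb by blast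

text \<open>This gives access to Tychonoff's theorem, from which compactness follows.\<close>

lemma symb_top_eq_product:
  "symb_top k = product_topology (\<lambda>_. discrete_topology {..<k}) UNIV"
proof -
  have "openin (symb_top k) U \<longleftrightarrow>
      openin (product_topology (\<lambda>_. discrete_topology {..<k}) UNIV) U" for U
  proof
    assume U: "openin (symb_top k) U"
    show "openin (product_topology (\<lambda>_. discrete_topology {..<k}) UNIV) U"
      unfolding openin_product_topology_alt
    proof
      fix x assume x: "x \<in> U"
      then obtain n where n: "\<And>y. y \<in> symb k \<Longrightarrow> agree n x y \<Longrightarrow> y \<in> U" and "x \<in> symb k"
        using U unfolding openin_symb_iff by blast
      define V where "V i = (if i < n then {x i} else {..<k})" for i
      have "finite {i \<in> UNIV. V i \<noteq> topspace (discrete_topology {..<k})}"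
        by (rule finite_subset[of _ "{..<n}"]) (auto simp: V_def)
      moreover have "Pi\<^sub>E UNIV V \<subseteq> U"
      proof
        fix y assume "y \<in> Pi\<^sub>E UNIV V"
        then have y: "y i \<in> V i" for i by auto
        have "y i < k" for i using y[of i] \<open>x \<in> symb k\<close> by (auto simp: V_def symb_def split: if_splits)
        moreover have "agree n x y" unfolding agree_def
        proof safe
          show "x i = y i" if "i < n" for i using y[of i] that by (simp add: V_def)
        qed
        ultimately show "y \<in> U" using n by (simp add: symb_def)
      qed
      ultimately show "\<exists>V. finite {i \<in> UNIV. V i \<noteq> topspace (discrete_topology {..<k})} \<and>
          (\<forall>i\<in>UNIV. openin (discrete_topology {..<k}) (V i)) \<and> x \<in> Pi\<^sub>E UNIV V \<and> Pi\<^sub>E UNIV V \<subseteq> U"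
        using \<open>x \<in> symb k\<close> by (intro exI[of _ V]) (auto simp: V_def symb_def)
    qed
  next
    assume "openin (product_topology (\<lambda>_. discrete_topology {..<k}) UNIV) U"
    note U = this[unfolded openin_product_topology_alt]
    show "openin (symb_top k) U"
      unfolding openin_symb_iff
    proof (intro conjI ballI subsetI)
      fix x assume "x \<in> U"
      then obtain V where V: "finite {i. V i \<noteq> {..<k}}" "\<And>i. V i \<subseteq> {..<k}"
          "x \<in> Pi\<^sub>E UNIV V" "Pi\<^sub>E UNIV V \<subseteq> U"
        using U by (auto simp: Ball_def)
      then show "x \<in> symb k" by (auto simp: symb_def PiE_def Pi_def)
      obtain n where n: "{i. V i \<noteq> {..<k}} \<subseteq> {..<n}" using V(1) finite_nat_iff_bounded by blast
      have "y \<in> U" if y: "y \<in> symb k" "agree n x y" for y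
      proof -
        have "y i \<in> V i" for i
        proof (cases "i < n")
          case True
          then have "y i = x i" using y(2) by (simp add: agree_def)
          moreover have "x i \<in> V i" using V(3) by auto
          ultimately show ?thesis by simp
        next
          case False
          then have "V i = {..<k}" using n by blast
          then show ?thesis using y(1) by (simp add: symb_def)
        qed
        then show ?thesis using V(4) by auto
      qed
      then show "\<exists>n. \<forall>y\<in>symb k. agree n x y \<longrightarrow> y \<in> U" by blast
    qed
  qed
  then show ?thesis by (simp add: topology_eq)
qed

lemma compact_space_symb: "compact_space (symb_top k)"
  unfolding symb_top_eq_product compact_space_product_topology
  by (simp add: compact_space_discrete_topology)

text \<open>If each point had a cylinder visited at only finitely many indices in \<open>I\<close>,
  a finite subcover by such cylinders would make \<open>I\<close> finite.\<close>

lemma symb_accumulation: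
  assumes u: "\<And>n. u n \<in> symb k" and I: "infinite (I :: nat set)"
  shows "\<exists>y\<in>symb k. \<forall>N. infinite {n \<in> I. agree N y (u n)}"
proof (rule ccontr)
  assume "\<not> ?thesis"
  then have "\<forall>y\<in>symb k. \<exists>N. finite {n \<in> I. agree N y (u n)}" by blast
  then obtain N where N: "\<And>y. y \<in> symb k \<Longrightarrow> finite {n \<in> I. agree (N y) y (u n)}"
    by metis
  define C where "C y = {z \<in> symb k. agree (N y) y z}" for y
  have "symb k \<subseteq> \<Union> (C ` symb k)" by (auto simp: C_def)
  moreover have "\<forall>U \<in> C ` symb k. openin (symb_top k) U"
    by (auto simp: C_def openin_symb_agree)
  ultimately obtain F where F: "finite F" "F \<subseteq> C ` symb k" "symb k \<subseteq> \<Union> F"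
    using compact_space_symb[of k] unfolding compact_space_alt topspace_symb by meson
  then obtain Y where Y: "finite Y" "Y \<subseteq> symb k" "F = C ` Y"
    by (metis finite_subset_image)
  have "I \<subseteq> (\<Union>y\<in>Y. {n \<in> I. agree (N y) y (u n)})"
    using F(3) u Y by (fastforce simp: C_def)
  moreover have "finite (\<Union>y\<in>Y. {n \<in> I. agree (N y) y (u n)})"
    using Y N by blast
  ultimately show False using I finite_subset by blast
qed

section \<open>Limit sets, basins and criteria for attractors\<close>

lemma funpow_in_symb: "T \<in> symb k \<rightarrow> symb k \<Longrightarrow> x \<in> symb k \<Longrightarrow> (T ^^ n) x \<in> symb k"
  by (induction n) auto

lemma omega_limit_iff:
  assumes "T \<in> symb k \<rightarrow> symb k" "x \<in> symb k"
  shows "y \<in> omega_limit k T x \<longleftrightarrow> y \<in> symb k \<and> (\<forall>N. \<exists>\<^sub>\<infinity>n. agree N y ((T ^^ n) x))"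
proof (intro iffI conjI allI)
  fix N assume y: "y \<in> omega_limit k T x"
  have "\<exists>\<^sub>\<infinity>n. (T ^^ n) x \<in> {z \<in> symb k. agree N y z}"
    using y openin_symb_agree[of k N y] by (auto simp: omega_limit_def)
  then show "\<exists>\<^sub>\<infinity>n. agree N y ((T ^^ n) x)" by (rule INFM_mono) simp
next
  assume y: "y \<in> symb k \<and> (\<forall>N. \<exists>\<^sub>\<infinity>n. agree N y ((T ^^ n) x))"
  have "\<exists>\<^sub>\<infinity>n. (T ^^ n) x \<in> U" if U: "openin (symb_top k) U" "y \<in> U" for U
  proof -
    obtain N where N: "\<And>z. z \<in> symb k \<Longrightarrow> agree N y z \<Longrightarrow> z \<in> U"
      using U unfolding openin_symb_iff by blast
    from y have "\<exists>\<^sub>\<infinity>n. agree N y ((T ^^ n) x)" by blast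
    then show ?thesis by (rule INFM_mono) (simp add: N funpow_in_symb assms)
  qed
  then show "y \<in> omega_limit k T x" using y by (simp add: omega_limit_def)
qed (simp add: omega_limit_def)

text \<open>By compactness the limit set lies in \<open>A\<close> exactly when the orbit converges
  to \<open>A\<close>. In this form the basin is a countable combination of conditions on single
  iterates, hence measurable.\<close>

lemma basin_iff:
  assumes T: "T \<in> symb k \<rightarrow> symb k" and A: "closedin (symb_top k) A"
  shows "x \<in> basin k T A \<longleftrightarrow>
    x \<in> symb k \<and> (\<forall>N. \<exists>m. \<forall>n\<ge>m. \<exists>a\<in>A. agree N a ((T ^^ n) x))"
proof (cases "x \<in> symb k")
  case x: True
  have "omega_limit k T x \<subseteq> A \<longleftrightarrow> (\<forall>N. \<exists>m. \<forall>n\<ge>m. \<exists>a\<in>A. agree N a ((T ^^ n) x))"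
  proof
    assume sub: "omega_limit k T x \<subseteq> A"
    show "\<forall>N. \<exists>m. \<forall>n\<ge>m. \<exists>a\<in>A. agree N a ((T ^^ n) x)"
    proof (rule ccontr)
      assume "\<not> ?thesis"
      then obtain N where N: "\<forall>m. \<exists>n\<ge>m. \<not> (\<exists>a\<in>A. agree N a ((T ^^ n) x))" by blast
      \<comment> \<open>Times at which the orbit is away from \<open>A\<close>: an accumulation
        point along them is in the limit set, so in \<open>A\<close>, although the orbit returns
        close to it at times in \<open>I\<close>.\<close>
      define I where "I = {n. \<not> (\<exists>a\<in>A. agree N a ((T ^^ n) x))}"
      have "infinite I" using N by (auto simp: I_def infinite_nat_iff_unbounded_le)
      with symb_accumulation[of "\<lambda>n. (T ^^ n) x", OF funpow_in_symb[OF T x]] obtain y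
        where y: "y \<in> symb k" "\<And>N. infinite {n \<in> I. agree N y ((T ^^ n) x)}" by blast
      have "\<exists>\<^sub>\<infinity>n. agree N y ((T ^^ n) x)" for N
        unfolding INFM_iff_infinite using y(2)[of N] by (rule infinite_super[rotated]) auto
      then have "y \<in> A" using sub y(1) omega_limit_iff[OF T x] by blast
      moreover obtain n where "n \<in> I" "agree N y ((T ^^ n) x)"
        using y(2)[of N] not_finite_existsD by auto
      ultimately show False by (auto simp: I_def)
    qed
  next
    assume R: "\<forall>N. \<exists>m. \<forall>n\<ge>m. \<exists>a\<in>A. agree N a ((T ^^ n) x)"
    show "omega_limit k T x \<subseteq> A"
    proof
      fix y assume y: "y \<in> omega_limit k T x"
      have "\<exists>a\<in>A. agree N y a" for N
      proof -
        obtain m where m: "\<forall>n\<ge>m. \<exists>a\<in>A. agree N a ((T ^^ n) x)" using R by blast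
        obtain n where "n \<ge> m" "agree N y ((T ^^ n) x)"
          using y omega_limit_iff[OF T x] by (meson INFM_nat_le)
        then show ?thesis using m agree_trans agree_sym by blast
      qed
      then show "y \<in> A" using A y omega_limit_iff[OF T x] unfolding closedin_symb_iff by blast
    qed
  qed
  then show ?thesis using x by (simp add: basin_def)
qed (simp add: basin_def)

text \<open>Uniform continuity, written with prefixes: \<open>m\<close> depends on \<open>n\<close>
  only. Then whether an iterate is close to a given set depends on finitely many letters.\<close>

definition symb_continuous :: "nat \<Rightarrow> ((nat \<Rightarrow> nat) \<Rightarrow> (nat \<Rightarrow> nat)) \<Rightarrow> bool" where
  "symb_continuous k T \<longleftrightarrow> T \<in> symb k \<rightarrow> symb k \<and>
     (\<forall>n. \<exists>m. \<forall>x\<in>symb k. \<forall>y\<in>symb k. agree m x y \<longrightarrow> agree n (T x) (T y))"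

lemma symb_continuous_funpow: "symb_continuous k T \<Longrightarrow> symb_continuous k (T ^^ j)"
proof (induction j)
  case 0
  then show ?case by (auto simp: symb_continuous_def)
next
  case (Suc j)
  then show ?case unfolding symb_continuous_def
    by (simp add: Pi_iff) (meson)
qed

text \<open>The set is the union of the cylinders given by the prefixes of its elements, and there
  are only countably many words.\<close>

lemma sets_bernoulli_finite_dep:
  assumes S: "S \<subseteq> symb k" and dep: "\<And>x y. x \<in> S \<Longrightarrow> y \<in> symb k \<Longrightarrow> agree n x y \<Longrightarrow> y \<in> S"
  shows "S \<in> sets (bernoulli k)"
proof -
  have coord: "{x \<in> space (bernoulli k). x i = a} \<in> sets (bernoulli k)" for i a
  proof (cases "a < k")
    case True
    have "(\<lambda>x. x i) \<in> measurable (bernoulli k) (uniform_count_measure {..<k})"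
      unfolding bernoulli_def by (rule measurable_component_singleton) simp
    from measurable_sets[OF this, of "{a}"] True show ?thesis
      by (simp add: vimage_def Int_def conj_commute sets_uniform_count_measure)
  next
    case False
    then have empty: "{x \<in> space (bernoulli k). x i = a} = {}"
      by (auto simp: space_bernoulli symb_def)
    show ?thesis unfolding empty by simp
  qed
  have cyl: "{x \<in> space (bernoulli k). \<forall>i<n. x i = w ! i} \<in> sets (bernoulli k)" for w
  proof -
    have "{x \<in> space (bernoulli k). \<forall>i\<in>{..<n}. x i = w ! i} \<in> sets (bernoulli k)"
      by (intro sets.sets_Collect_finite_All coord) simp
    then show ?thesis by (simp only: Ball_def lessThan_iff)
  qed
  have "(\<Union>w\<in>(\<lambda>x. map x [0..<n]) ` S. {x \<in> space (bernoulli k). \<forall>i<n. x i = w ! i})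
      \<in> sets (bernoulli k)"
    by (rule sets.countable_UN'[OF countableI_type]) (use cyl in blast)
  also have "(\<Union>w\<in>(\<lambda>x. map x [0..<n]) ` S. {x \<in> space (bernoulli k). \<forall>i<n. x i = w ! i}) = S"
  proof (intro equalityI subsetI)
    fix y assume "y \<in> (\<Union>w\<in>(\<lambda>x. map x [0..<n]) ` S. {x \<in> space (bernoulli k). \<forall>i<n. x i = w ! i})"
    then obtain x where "x \<in> S" "y \<in> symb k" "\<forall>i<n. y i = map x [0..<n] ! i"
      by (auto simp: space_bernoulli)
    then show "y \<in> S" using dep[of x y] by (simp add: agree_def)
  next
    fix y assume "y \<in> S"
    then show "y \<in> (\<Union>w\<in>(\<lambda>x. map x [0..<n]) ` S. {x \<in> space (bernoulli k). \<forall>i<n. x i = w ! i})"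
      using S by (auto simp: space_bernoulli intro!: bexI[of _ y])
  qed
  finally show ?thesis .
qed

lemma basin_in_sets:
  assumes T: "symb_continuous k T" and A: "closedin (symb_top k) A"
  shows "basin k T A \<in> sets (bernoulli k)"
proof -
  define S where "S N n = {x \<in> symb k. \<exists>a\<in>A. agree N a ((T ^^ n) x)}" for N n
  have S: "S N n \<in> sets (bernoulli k)" for N n
  proof -
    obtain m where m: "\<And>x y. x \<in> symb k \<Longrightarrow> y \<in> symb k \<Longrightarrow> agree m x y \<Longrightarrow>
        agree N ((T ^^ n) x) ((T ^^ n) y)"
      using symb_continuous_funpow[OF T, of n] unfolding symb_continuous_def by meson
    show ?thesis
      by (rule sets_bernoulli_finite_dep[where n = m])
        (unfold S_def, blast, simp, meson m agree_trans)
  qed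
  have "basin k T A = (\<Inter>N. \<Union>m. \<Inter>n\<in>{m..}. S N n)"
  proof (rule set_eqI)
    fix x
    have "T \<in> symb k \<rightarrow> symb k" using T by (simp add: symb_continuous_def)
    then have "x \<in> basin k T A \<longleftrightarrow> (\<forall>N. \<exists>m. \<forall>n\<ge>m. x \<in> S N n)"
      by (cases "x \<in> symb k") (auto simp: basin_iff[OF _ A] S_def)
    also have "\<dots> \<longleftrightarrow> x \<in> (\<Inter>N. \<Union>m. \<Inter>n\<in>{m..}. S N n)"
      by (simp only: INT_iff UN_iff bex_UNIV ball_UNIV) (simp only: Ball_def atLeast_iff)
    finally show "x \<in> basin k T A \<longleftrightarrow> x \<in> (\<Inter>N. \<Union>m. \<Inter>n\<in>{m..}. S N n)" .
  qed
  moreover have "(\<Inter>n\<in>{m..}. S N n) \<in> sets (bernoulli k)" for N and m :: nat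
    by (rule sets.countable_INT') (use S in auto)
  then have "(\<Union>m. \<Inter>n\<in>{m..}. S N n) \<in> sets (bernoulli k)" for N
    by (intro sets.countable_UN) blast
  then have "(\<Inter>N. \<Union>m. \<Inter>n\<in>{m..}. S N n) \<in> sets (bernoulli k)"
    by (intro sets.countable_INT') auto
  ultimately show ?thesis by simp
qed

text \<open>When almost all points share one limit set, minimality comes for free: the basin of a
  proper closed subset contains none of these points.\<close>

lemma metric_attractorI:
  assumes k: "0 < k" and T: "symb_continuous k T" and A: "closedin (symb_top k) A"
    and ae: "AE x in bernoulli k. omega_limit k T x = A"
  shows "metric_attractor k T A"
proof -
  interpret prob_space "bernoulli k" using prob_space_bernoulli[OF k] .
  have "AE x in bernoulli k. x \<in> basin k T A"
    using ae AE_space by eventually_elim (auto simp: basin_def space_bernoulli)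
  then have "emeasure (bernoulli k) (basin k T A) = 1"
    by (rule emeasure_eq_1_AE[OF basin_in_sets[OF T A]])
  moreover have "emeasure (bernoulli k) (basin k T A') = 0"
    if A': "closedin (symb_top k) A'" "A' \<subset> A" for A'
  proof -
    have "AE x in bernoulli k. x \<notin> basin k T A'"
      using ae by eventually_elim (use A' in \<open>auto simp: basin_def\<close>)
    then show ?thesis
      using AE_iff_null_sets[OF basin_in_sets[OF T A'(1)]] by auto
  qed
  ultimately show ?thesis using A by (auto simp: metric_attractor_def)
qed

lemma generic_mono: "generic X G \<Longrightarrow> G \<subseteq> H \<Longrightarrow> generic X H"
  unfolding generic_def by blast

text \<open>The same argument with generic in place of full measure: the basin of a proper closed
  subset misses a generic set.\<close>

lemma topological_attractorI:
  assumes A: "closedin (symb_top k) A"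
    and gen: "generic (symb_top k) {x \<in> symb k. omega_limit k T x = A}"
  shows "topological_attractor k T A"
  unfolding topological_attractor_def
proof (intro conjI A notI)
  show "generic (symb_top k) (basin k T A)"
    by (rule generic_mono[OF gen]) (auto simp: basin_def)
  assume "\<exists>A'. closedin (symb_top k) A' \<and> A' \<subset> A \<and> \<not> meager (symb_top k) (basin k T A')"
  then obtain A' where "A' \<subset> A" and m: "\<not> meager (symb_top k) (basin k T A')" by blast
  have "generic (symb_top k) (symb k - basin k T A')"
    by (rule generic_mono[OF gen]) (use \<open>A' \<subset> A\<close> in \<open>auto simp: basin_def\<close>)
  then show False using m by (simp add: meager_def)
qed

lemma genericI_agree:
  assumes "\<And>n :: nat. openin (symb_top k) (U n)"
    and "\<And>n N x. x \<in> symb k \<Longrightarrow> \<exists>y\<in>U n. agree N x y"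
    and "(\<Inter>n. U n) \<subseteq> G"
  shows "generic (symb_top k) G"
proof -
  have "symb_top k closure_of (U n) = topspace (symb_top k)" for n
  proof (intro equalityI subsetI)
    fix x assume "x \<in> topspace (symb_top k)"
    then have x: "x \<in> symb k" by simp
    have "\<exists>y. y \<in> U n \<and> y \<in> V" if V: "x \<in> V \<and> openin (symb_top k) V" for V
    proof -
      obtain N where N: "\<And>z. z \<in> symb k \<Longrightarrow> agree N x z \<Longrightarrow> z \<in> V"
        using V unfolding openin_symb_iff by blast
      obtain y where y: "y \<in> U n" "agree N x y" using assms(2)[OF x] by blast
      then have "y \<in> symb k" using openin_subset[OF assms(1)] by auto
      then show ?thesis using y N by blast
    qed
    then show "x \<in> symb_top k closure_of (U n)" using x unfolding in_closure_of by simp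
  qed (simp add: in_closure_of)
  then show ?thesis using assms(1,3) unfolding generic_def by blast
qed

section \<open>Probabilities of finitely many letter conditions\<close>

lemma emeasure_bernoulli_Collect:
  assumes k: "0 < k" and J: "finite J" and B: "B \<subseteq> {..<k}"
  shows "emeasure (bernoulli k) {x \<in> symb k. \<forall>i\<in>J. x i \<in> B} = ennreal ((real (card B) / k) ^ card J)"
proof -
  interpret product_prob_space "\<lambda>_::nat. uniform_count_measure {..<k}" UNIV
    by (intro product_prob_spaceI prob_space_uniform_count_measure) (use k in auto)
  have "emeasure (bernoulli k) {x \<in> symb k. \<forall>i\<in>J. x i \<in> B} =
      (\<Prod>i\<in>J. emeasure (uniform_count_measure {..<k}) B)"
    using emeasure_PiM_Collect[of J "\<lambda>_. B"] J B
    by (simp add: space_bernoulli[symmetric] bernoulli_def[symmetric] sets_uniform_count_measure)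
  also have "emeasure (uniform_count_measure {..<k}) B = ennreal (real (card B) / k)"
    using B by (subst emeasure_uniform_count_measure)
      (auto intro: finite_subset simp: ennreal_of_nat_eq_real_of_nat divide_ennreal k)
  finally show ?thesis by (simp add: ennreal_power)
qed

lemma measure_bernoulli_Collect:
  assumes "0 < k" "finite J" "B \<subseteq> {..<k}"
  shows "measure (bernoulli k) {x \<in> symb k. \<forall>i\<in>J. x i \<in> B} = (real (card B) / k) ^ card J"
  unfolding measure_def emeasure_bernoulli_Collect[OF assms] by simp

lemma sets_bernoulli_Collect:
  assumes "finite J"
  shows "{x \<in> symb k. \<forall>i\<in>J. x i \<in> B} \<in> sets (bernoulli k)"
proof -
  obtain n where "J \<subseteq> {..<n}" using assms finite_nat_iff_bounded by blast
  then show ?thesis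
    by (intro sets_bernoulli_finite_dep[where n = n]) (auto simp: agree_def subset_iff)
qed

text \<open>Decidability lists both the balls that meet \<open>A\<close> and those that miss it, and
  the latter cover the complement because \<open>A\<close> is closed.\<close>

lemma computable_closedI:
  assumes k: "0 < k" and A: "closedin (symb_top k) A"
    and dec: "recursive_pred (\<lambda>i. A \<inter> ideal_ball k i \<noteq> {})"
  shows "computable_closed k A"
proof -
  have re: "rec_enumerable {i. P i}" if "recursive_pred P" for P
  proof -
    have "recursive (\<lambda>i. if P i then Suc i else 0)" using that by (intro recursive_intro)
    moreover have "enumerates (\<lambda>i. if P i then Suc i else 0) {i. P i}"
      by (auto simp: enumerates_def)
    ultimately show ?thesis unfolding rec_enumerable_def using recursive_imp_computable_fun by blast
  qed
  have "upper_computable k A" unfolding upper_computable_def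
  proof (intro exI conjI)
    show "rec_enumerable {i. \<not> A \<inter> ideal_ball k i \<noteq> {}}"
      by (rule re[OF recursive_pred_not[OF dec]])
    show "symb k - A = (\<Union>i\<in>{i. \<not> A \<inter> ideal_ball k i \<noteq> {}}. ideal_ball k i)"
    proof (intro equalityI subsetI)
      fix x assume "x \<in> symb k - A"
      then obtain n where x: "x \<in> symb k" and n: "\<And>a. a \<in> A \<Longrightarrow> \<not> agree n x a"
        using A unfolding closedin_symb_iff by blast
      \<comment> \<open>\<open>ball_length\<close> ignores the coded word, so the length
        \<open>L\<close> is known before the center is chosen as the first \<open>L\<close> letters
        of \<open>x\<close>. As \<open>L\<close> exceeds \<open>n\<close>, the ball misses
        \<open>A\<close>.\<close>
      define L where "L = ball_length (pr 0 (pr 0 (2 ^ n)))"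
      define i where "i = pr (list_encode (map x [0..<L])) (pr 0 (2 ^ n))"
      have len: "ball_length i = L" by (simp add: i_def L_def ball_length_def)
      have agr: "agree L (ideal_center k i) x"
        using x by (simp add: agree_def ideal_center_eq i_def nth_code_list_encode symb_def)
      then have "x \<in> ideal_ball k i" using x len by (simp add: in_ideal_ball_iff[OF k])
      moreover have "A \<inter> ideal_ball k i = {}"
      proof (rule ccontr)
        assume "A \<inter> ideal_ball k i \<noteq> {}"
        then obtain a where "a \<in> A" "agree L (ideal_center k i) a"
          using len by (auto simp: in_ideal_ball_iff[OF k])
        then have "agree L x a" using agr agree_sym agree_trans by blast
        then have "agree n x a"
          using agree_mono less_imp_le[OF ball_length_gt[of n 0]] unfolding L_def by blast
        then show False using n[OF \<open>a \<in> A\<close>] by blast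
      qed
      ultimately show "x \<in> (\<Union>i\<in>{i. \<not> A \<inter> ideal_ball k i \<noteq> {}}. ideal_ball k i)" by blast
    next
      fix x assume "x \<in> (\<Union>i\<in>{i. \<not> A \<inter> ideal_ball k i \<noteq> {}}. ideal_ball k i)"
      then show "x \<in> symb k - A" using in_ideal_ball_iff[OF k] by blast
    qed
  qed
  then show ?thesis using A re[OF dec] by (simp add: computable_closed_def lower_computable_def)
qed

section \<open>The limit sets\<close>

text \<open>For \<open>c = 0\<close> the two positions coincide and there is a single one.\<close>

definition spike :: "nat \<Rightarrow> nat \<Rightarrow> nat \<Rightarrow> nat" where
  "spike j c i = (if i = j \<or> i = j + c then 1 else 0)"

text \<open>The zero sequence is the limit of \<open>spike j c\<close> for growing \<open>j\<close>.
  For growing \<open>c\<close> the limit is \<open>spike j 0\<close>, so the assumption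
  \<open>0 \<in> S\<close> made below keeps the set closed.\<close>

definition spikes :: "nat set \<Rightarrow> (nat \<Rightarrow> nat) set" where
  "spikes S = insert (\<lambda>_. 0) {spike j c | j c. c \<in> S}"

text \<open>Each instance of these conditions concerns at most three positions and therefore passes
  to limits. Both \<open>closedin_spikes\<close> and \<open>omega_limit_subset\<close> rest on
  this.\<close>

lemma spikes_iff:
  assumes "0 \<in> S"
  shows "x \<in> spikes S \<longleftrightarrow>
    (\<forall>i. x i \<le> 1) \<and> (\<forall>p q. p < q \<longrightarrow> x p = 1 \<longrightarrow> x q = 1 \<longrightarrow> q - p \<in> S) \<and>
    (\<forall>p q r. p < q \<longrightarrow> q < r \<longrightarrow> x p = 1 \<longrightarrow> x q = 1 \<longrightarrow> x r \<noteq> 1)"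
    (is "_ \<longleftrightarrow> ?R")
proof
  assume "x \<in> spikes S"
  then consider "x = (\<lambda>_. 0)" | j c where "c \<in> S" "x = spike j c"
    by (auto simp: spikes_def)
  then show ?R
  proof cases
    case 1
    then show ?thesis by simp
  next
    case 2
    then have one: "x i = 1 \<longleftrightarrow> i = j \<or> i = j + c" for i by (simp add: spike_def)
    have "x i \<le> 1" for i using 2 by (simp add: spike_def)
    then show ?thesis unfolding one using \<open>c \<in> S\<close> by auto
  qed
next
  assume R: ?R
  show "x \<in> spikes S"
  proof (cases "\<exists>p. x p = 1")
    case False
    then have "x = (\<lambda>_. 0)" using R by (metis One_nat_def le_Suc_eq le_zero_eq)
    then show ?thesis by (simp add: spikes_def)
  next
    case True
    \<comment> \<open>The first one of \<open>x\<close>; the last condition then allows at most one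
      more.\<close>
    define p where "p = (LEAST p. x p = 1)"
    have p: "x p = 1" "\<And>q. x q = 1 \<Longrightarrow> p \<le> q"
      unfolding p_def using LeastI_ex[OF True] by (auto intro: Least_le)
    have zero: "x i = 0" if "x i \<noteq> 1" for i
      using R that by (metis One_nat_def le_Suc_eq le_zero_eq)
    show ?thesis
    proof (cases "\<exists>q. q \<noteq> p \<and> x q = 1")
      case False
      then have "x = spike p 0" using p(1) zero by (fastforce simp: spike_def)
      then show ?thesis using assms by (auto simp: spikes_def)
    next
      case True
      then obtain q where q: "p < q" "x q = 1" using p(2) by (metis le_neq_implies_less)
      have "x i = 1 \<longleftrightarrow> i = p \<or> i = q" for i
      proof
        assume i: "x i = 1"
        show "i = p \<or> i = q"
        proof (rule ccontr)
          assume "\<not> (i = p \<or> i = q)"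
          then have "p < i" "i < q \<or> q < i" using p(2)[OF i] by auto
          then show False using R p(1) q i by blast
        qed
      qed (use p q in auto)
      then have "x = spike p (q - p)" using q(1) zero by (fastforce simp: spike_def)
      moreover have "q - p \<in> S" using R p(1) q by blast
      ultimately show ?thesis by (auto simp: spikes_def)
    qed
  qed
qed

lemma spike_in_spikes: "c \<in> S \<Longrightarrow> spike j c \<in> spikes S"
  by (auto simp: spikes_def)

lemma spikes_subset_symb: "2 \<le> k \<Longrightarrow> spikes S \<subseteq> symb k"
  by (auto simp: spikes_def symb_def spike_def)

lemma closedin_spikes:
  assumes k: "2 \<le> k" and S: "0 \<in> S"
  shows "closedin (symb_top k) (spikes S)"
  unfolding closedin_symb_iff
proof (intro conjI ballI impI spikes_subset_symb k)
  fix x assume "\<forall>n. \<exists>a\<in>spikes S. agree n x a"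
  then have ex: "\<exists>a\<in>spikes S. \<forall>i\<le>n. x i = a i" for n
    unfolding agree_def by (meson le_imp_less_Suc)
  show "x \<in> spikes S" unfolding spikes_iff[OF S]
  proof (intro conjI allI impI)
    show "x i \<le> 1" for i using ex[of i] spikes_iff[OF S] by force
  next
    fix p q assume "p < q" "x p = 1" "x q = 1"
    moreover obtain a where "a \<in> spikes S" "\<forall>i\<le>q. x i = a i" using ex by blast
    ultimately show "q - p \<in> S" using spikes_iff[OF S] by (metis less_imp_le order_refl)
  next
    fix p q r assume "p < q" "q < r" "x p = 1" "x q = 1"
    moreover obtain a where "a \<in> spikes S" "\<forall>i\<le>r. x i = a i" using ex by blast
    ultimately show "x r \<noteq> 1"
      using spikes_iff[OF S] by (metis less_imp_le less_trans order_refl)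
  qed
qed

text \<open>A prefix of length \<open>N\<close> cannot see positions from \<open>N\<close> on: the
  zero sequence, or a first one beyond the prefix, is replaced by \<open>spike N 0\<close>, and a
  gap \<open>c > N\<close> by the gap \<open>0\<close>. So a bounded search suffices.\<close>

lemma agree_spikes_iff:
  assumes S: "0 \<in> S"
  shows "(\<exists>x\<in>spikes S. agree N w x) \<longleftrightarrow>
    (\<exists>j<Suc N. \<exists>c<Suc N. c \<in> S \<and> agree N w (spike j c))"
proof
  assume "\<exists>x\<in>spikes S. agree N w x"
  then obtain x where x: "x \<in> spikes S" "agree N w x" ..
  then consider "x = (\<lambda>_. 0)" | j c where "c \<in> S" "x = spike j c"
    by (auto simp: spikes_def)
  then show "\<exists>j<Suc N. \<exists>c<Suc N. c \<in> S \<and> agree N w (spike j c)"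
  proof cases
    case 1
    then have "agree N w (spike N 0)" using x by (auto simp: agree_def spike_def)
    then show ?thesis using S by blast
  next
    case 2
    consider "N \<le> j" | "j < N" "c \<le> N" | "j < N" "N < c" by linarith
    then show ?thesis
    proof cases
      case 1
      then have "agree N w (spike N 0)" using x 2 by (auto simp: agree_def spike_def)
      then show ?thesis using S by blast
    next
      assume "j < N" "c \<le> N"
      then show ?thesis using x 2 by (metis less_Suc_eq_le less_imp_le)
    next
      case 3
      then have "agree N w (spike j 0)" using x 2 by (auto simp: agree_def spike_def)
      then show ?thesis using S 3 by (metis less_SucI zero_less_Suc)
    qed
  qed
qed (use spike_in_spikes in blast)

lemma recursive_pred_agree_center [recursive_intro]:
  assumes "recursive n" "recursive i" "recursive j" "recursive c"
  shows "recursive_pred (\<lambda>x. agree (n x) (ideal_center 3 (i x)) (spike (j x) (c x)))"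
  unfolding agree_def ideal_center_eq spike_def
  by (rule recursive_pred_all_less[OF assms(1)])
    (intro recursive_intro assms(2-)[THEN recursive_compose, OF recursive_p1])

lemma computable_closed_spikes:
  assumes S: "0 \<in> S" and rec: "recursive_pred (\<lambda>c. c \<in> S)"
  shows "computable_closed 3 (spikes S)"
proof (rule computable_closedI)
  have "spikes S \<inter> ideal_ball 3 i \<noteq> {} \<longleftrightarrow>
      (\<exists>x\<in>spikes S. agree (ball_length i) (ideal_center 3 i) x)" for i
    unfolding ex_in_conv[symmetric] Int_iff in_ideal_ball_iff[OF zero_less_numeral]
    using spikes_subset_symb[of 3 S] by auto
  then have "(\<lambda>i. spikes S \<inter> ideal_ball 3 i \<noteq> {}) =
    (\<lambda>i. \<exists>j<Suc (ball_length i). \<exists>c<Suc (ball_length i).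
      c \<in> S \<and> agree (ball_length i) (ideal_center 3 i) (spike j c))"
    unfolding agree_spikes_iff[OF S] by (rule ext)
  moreover have "recursive_pred \<dots>"
    by (intro recursive_intro recursive_pred_compose[OF rec])
  ultimately show "recursive_pred (\<lambda>i. spikes S \<inter> ideal_ball 3 i \<noteq> {})" by simp
qed (use closedin_spikes S in simp_all)

section \<open>Outer collections and completeness\<close>

lemma outer_collection_spikes_iff:
  assumes "0 \<in> S"
  shows "i \<in> outer_collection 3 (spikes S) \<longleftrightarrow>
    (\<forall>j<Suc (cball_length i). \<forall>c<Suc (cball_length i).
      agree (cball_length i) (ideal_center 3 i) (spike j c) \<longrightarrow> c \<notin> S)"
proof -
  have "i \<in> outer_collection 3 (spikes S) \<longleftrightarrow>
      \<not> (\<exists>x\<in>spikes S. agree (cball_length i) (ideal_center 3 i) x)"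
    unfolding outer_collection_def mem_Collect_eq disjoint_iff
      in_ideal_cball_iff[OF zero_less_numeral]
    using spikes_subset_symb[of 3 S] by auto
  then show ?thesis unfolding agree_spikes_iff[OF assms] by blast
qed

text \<open>Both ones of either sequence lie inside the common prefix, which thus determines their
  distance.\<close>

lemma agree_spike_unique:
  assumes "agree N (spike j c) (spike j' c')" "j + c < N" "j' + c' < N" "0 < c" "0 < c'"
  shows "c = c'"
proof -
  have eq: "i = j \<or> i = j + c \<longleftrightarrow> i = j' \<or> i = j' + c'" if "i < N" for i
  proof -
    have "spike j c i = spike j' c' i" using assms(1) that by (simp add: agree_def)
    then show ?thesis unfolding spike_def by (metis zero_neq_one)
  qed
  have "j < N" "j' < N" using assms(2,3) by simp_all
  then have "j = j' \<or> j = j' + c'" "j + c = j' \<or> j + c = j' + c'" "j' = j \<or> j' = j + c"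
    using eq[of j] eq[of "j + c"] eq[of j'] assms(2) by simp_all
  then show ?thesis using assms(4,5) by (elim disjE) linarith+
qed

text \<open>A ball is outside iff every matching \<open>c\<close> lies outside
  \<open>univ_Pi2\<close>, which asks for some \<open>y\<close> without witness for each such
  \<open>c\<close>. All matching \<open>c\<close> turn out to be equal, so one \<open>y\<close>
  serves for all and the existential quantifier can be moved to the front.\<close>

lemma Pi_compact_spikes: "Pi_compact 3 2 (spikes univ_Pi2)"
proof -
  let ?S = univ_Pi2
  \<comment> \<open>Here \<open>u\<close> codes \<open>((i, y), w)\<close>. Below, \<open>C\<close>
    is the decidable bottom layer, and \<open>B\<close> has the projection of \<open>C\<close> as
    its complement.\<close>
  define M where "M u \<longleftrightarrow> (\<forall>j<Suc (cball_length (p1 (p1 u))). \<forall>c<Suc (cball_length (p1 (p1 u))).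
     agree (cball_length (p1 (p1 u))) (ideal_center 3 (p1 (p1 u))) (spike j c) \<longrightarrow>
     \<not> wit c (p2 (p1 u)) (p2 u))" for u
  have M: "recursive_pred M" unfolding M_def by (intro recursive_intro)
  define C where "C = {u. \<not> M u}"
  define B where "B = - {z. \<exists>w. prod_encode (z, w) \<in> C}"
  have outer: "i \<in> outer_collection 3 (spikes ?S) \<longleftrightarrow> (\<exists>y. prod_encode (i, y) \<in> B)" for i
  proof -
    let ?N = "cball_length i"
    let ?match = "\<lambda>j c. agree ?N (ideal_center 3 i) (spike j c)"
    have "(\<exists>y. prod_encode (i, y) \<in> B) \<longleftrightarrow>
        (\<exists>y. \<forall>w. \<forall>j<Suc ?N. \<forall>c<Suc ?N. ?match j c \<longrightarrow> \<not> wit c y w)"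
      by (simp add: B_def C_def M_def pr_def[symmetric]) blast
    also have "\<dots> \<longleftrightarrow> (\<forall>j<Suc ?N. \<forall>c<Suc ?N. ?match j c \<longrightarrow> c \<notin> ?S)" (is "?L \<longleftrightarrow> ?R")
    proof
      assume ?L
      then show ?R unfolding univ_Pi2_def by blast
    next
      assume R: ?R
      show ?L
      proof (cases "\<exists>j<Suc ?N. \<exists>c<Suc ?N. ?match j c")
        case True
        then obtain j c where jc: "j < Suc ?N" "c < Suc ?N" "?match j c" by blast
        then have "c \<notin> ?S" using R by blast
        then obtain y where y: "\<And>w. \<not> wit c y w" unfolding univ_Pi2_def by blast
        \<comment> \<open>A match with gap \<open>0\<close>, or with its second one beyond the
          prefix, would give a match with \<open>spike j' 0\<close>, which \<open>R\<close> forbids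
          because \<open>0\<close> is in \<open>univ_Pi2\<close>.\<close>
        have inside: "0 < c' \<and> j' + c' < ?N" if "j' < Suc ?N" "c' < Suc ?N" "?match j' c'" for j' c'
        proof -
          have "\<not> ?match j' 0" using R zero_in_univ_Pi2 that(1) by blast
          moreover have "agree ?N (spike j' c') (spike j' 0)" if "\<not> j' + c' < ?N"
            using that by (auto simp: agree_def spike_def)
          ultimately show ?thesis using that(3) agree_trans by (metis gr0I)
        qed
        have "c' = c" if "j' < Suc ?N" "c' < Suc ?N" "?match j' c'" for j' c'
          using agree_spike_unique[of ?N j' c' j c] inside[OF that] inside[OF jc] that jc
            agree_sym agree_trans by blast
        then show ?thesis using y by blast
      qed blast
    qed
    finally show ?thesis unfolding outer_collection_spikes_iff[OF zero_in_univ_Pi2] by blast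
  qed
  have "decidable (- C)"
    using recursive_pred_imp_decidable[of "- C"] M by (simp add: C_def)
  then have "arith_sigma 2 (outer_collection 3 (spikes ?S))"
    unfolding numeral_2_eq_2 arith_sigma.simps
    by (intro exI[of _ B] exI[of _ C] conjI) (use outer in \<open>auto simp: B_def\<close>)
  moreover have "compactin (symb_top 3) (spikes ?S)"
    by (rule closedin_compact_space[OF compact_space_symb closedin_spikes])
      (simp_all add: zero_in_univ_Pi2)
  ultimately show ?thesis by (simp add: Pi_compact_def)
qed

text \<open>By universality, \<open>x\<close> is in the outer collection of \<open>K'\<close> iff a
  computable \<open>c\<close> is outside \<open>univ_Pi2\<close>. The closed ball \<open>r x\<close>
  tests this: it fixes the ones of \<open>spike 0 c\<close>. So \<open>r\<close> is a many-one
  reduction between the outer collections, and it carries enumerations over.\<close>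

lemma Pi_complete_spikes: "Pi_complete 3 2 (spikes univ_Pi2)"
proof -
  let ?S = univ_Pi2
  have "enum_reducible (outer_collection 3 K') (outer_collection 3 (spikes ?S))"
    if K': "Pi_compact 3 2 K'" for K'
  proof -
    obtain p where p: "\<And>x. x \<in> outer_collection 3 K' \<longleftrightarrow> Suc (pr p x) \<notin> ?S"
      using univ_Pi2_universal K' unfolding Pi_compact_def by blast
    define r where "r x = pr (list_encode (map (spike 0 (Suc (pr p x))) [0..<Suc (Suc (pr p x))]))
      (pr 0 (2 ^ Suc (pr p x)))" for x
    have rec_r: "recursive r" unfolding r_def spike_def by (intro recursive_intro)
    have r: "r x \<in> outer_collection 3 (spikes ?S) \<longleftrightarrow> x \<in> outer_collection 3 K'" for x
    proof -
      \<comment> \<open>The successor makes \<open>c\<close> positive, so that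
        \<open>spike 0 c\<close> has two distinct ones and its distance \<open>c\<close> can be read
        off.\<close>
      define c where "c = Suc (pr p x)"
      have r: "r x = pr (list_encode (map (spike 0 c) [0..<Suc c])) (pr 0 (2 ^ c))"
        by (simp only: r_def c_def)
      have center: "ideal_center 3 (r x) = spike 0 c"
      proof
        show "ideal_center 3 (r x) i = spike 0 c i" for i
          unfolding ideal_center_eq r p1_pr nth_code_list_encode
          by (auto simp: spike_def nth_append simp del: upt_Suc)
      qed
      have len: "c < cball_length (r x)" unfolding r by (rule cball_length_gt)
      have "(\<exists>y\<in>spikes ?S. agree (cball_length (r x)) (spike 0 c) y) \<longleftrightarrow> c \<in> ?S"
      proof
        assume "\<exists>y\<in>spikes ?S. agree (cball_length (r x)) (spike 0 c) y"
        then obtain y where y: "y \<in> spikes ?S" "agree (cball_length (r x)) (spike 0 c) y" ..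
        then have "spike 0 c 0 = y 0" "spike 0 c c = y c" using len unfolding agree_def by auto
        then have "y 0 = 1" "y c = 1" by (simp_all add: spike_def)
        moreover have "0 < c" by (simp add: c_def)
        ultimately show "c \<in> ?S" using y(1) spikes_iff[OF zero_in_univ_Pi2] by (metis diff_zero)
      next
        show "c \<in> ?S \<Longrightarrow> \<exists>y\<in>spikes ?S. agree (cball_length (r x)) (spike 0 c) y"
          by (rule bexI[OF agree_refl spike_in_spikes])
      qed
      then have "r x \<in> outer_collection 3 (spikes ?S) \<longleftrightarrow> c \<notin> ?S"
        unfolding outer_collection_def mem_Collect_eq disjoint_iff
          in_ideal_cball_iff[OF zero_less_numeral] center
        using spikes_subset_symb[of 3 ?S] by auto
      then show ?thesis using p[of x] by (simp add: c_def)
    qed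
    \<comment> \<open>A number \<open>n\<close> codes a candidate \<open>p1 n\<close> and a position
      \<open>p2 n\<close> of the given enumeration. On \<open>pr n (f (p2 n))\<close>,
      \<open>G\<close> outputs the candidate if \<open>r\<close> of it is listed at that
      position.\<close>
    define G where "G u = (if p2 u = Suc (r (p1 (p1 u))) then Suc (p1 (p1 u)) else 0)" for u
    have "recursive G" unfolding G_def by (intro recursive_intro recursive_compose[OF rec_r])
    then obtain cG where cG: "\<And>f u. run cG f u = Some (G u)" unfolding recursive_def by metis
    obtain ci where ci: "\<And>f u. run ci f u = Some u" using recursive_id unfolding recursive_def by metis
    show ?thesis unfolding enum_reducible_def
    proof (intro exI allI impI conjI)
      fix f assume f: "enumerates f (outer_collection 3 (spikes ?S))"
      show "run (Comp cG (Pairing ci (Comp Oracle Snd))) f n = Some (G (pr n (f (p2 n))))" for n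
        by (simp add: cG ci pr_def p2_def)
      show "enumerates (\<lambda>n. G (pr n (f (p2 n)))) (outer_collection 3 K')"
        unfolding enumerates_def
      proof (intro equalityI subsetI CollectI)
        fix x assume "x \<in> outer_collection 3 K'"
        then have "r x \<in> outer_collection 3 (spikes ?S)" using r by blast
        then obtain m where "f m = Suc (r x)" using f unfolding enumerates_def by blast
        then show "\<exists>n. G (pr n (f (p2 n))) = Suc x"
          by (intro exI[of _ "pr x m"]) (simp add: G_def)
      next
        fix x assume "x \<in> {i. \<exists>n. G (pr n (f (p2 n))) = Suc i}"
        then obtain n where "G (pr n (f (p2 n))) = Suc x" by blast
        then have "f (p2 n) = Suc (r x)" by (auto simp: G_def split: if_splits)
        then have "r x \<in> outer_collection 3 (spikes ?S)" using f unfolding enumerates_def by blast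
        then show "x \<in> outer_collection 3 K'" using r by blast
      qed
    qed
  qed
  then show ?thesis using Pi_compact_spikes by (simp add: Pi_complete_def)
qed

section \<open>The dynamics\<close>

text \<open>The map cannot count its own iterations. As the marker moves from \<open>t\<close> to
  \<open>3 * t + 2\<close>, this logarithm of its position grows by one per step and serves as the
  index into \<open>g\<close> and \<open>h\<close>.\<close>

definition level :: "nat \<Rightarrow> nat" where
  "level t = (LEAST s. t < 3 ^ s)"

lemma level_step: "level (3 * t + 2) = Suc (level t)"
proof -
  have ex: "\<exists>s. t < 3 ^ s" for t :: nat
    by (rule exI[of _ t]) (induction t, auto)
  show ?thesis unfolding level_def[of "3 * t + 2"]
  proof (rule Least_equality)
    have "t < 3 ^ level t" unfolding level_def by (rule LeastI_ex[OF ex])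
    then show "3 * t + 2 < 3 ^ Suc (level t)" by simp
  next
    fix s assume s: "3 * t + 2 < 3 ^ s"
    then obtain s' where s': "s = Suc s'" by (cases s) auto
    then have "t < 3 ^ s'" using s by simp
    then have "level t \<le> s'" unfolding level_def by (rule Least_le)
    then show "Suc (level t) \<le> s" using s' by simp
  qed
qed

lemma recursive_level [recursive_intro]: "recursive a \<Longrightarrow> recursive (\<lambda>x. level (a x))"
proof -
  have "\<exists>s. t < 3 ^ s" for t :: nat
    by (rule exI[of _ t]) (induction t, auto)
  then have "recursive level" unfolding level_def by (intro recursive_intro)
  then show "recursive a \<Longrightarrow> recursive (\<lambda>x. level (a x))" by (rule recursive_compose)
qed

definition choice :: "(nat \<Rightarrow> nat) \<Rightarrow> (nat \<Rightarrow> nat) \<Rightarrow> (nat \<Rightarrow> nat) \<Rightarrow> nat \<Rightarrow> nat" where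
  "choice g h x t = (if \<forall>i<t. x (t + 1 + i) = 0 then h (level t) else g (level t))"

definition first_mark :: "(nat \<Rightarrow> nat) \<Rightarrow> nat \<Rightarrow> nat" where
  "first_mark x m = (LEAST i. x i = 2 \<or> i = m)"

text \<open>A number larger than \<open>t\<close> is not written, leaving a single one. Hence all
  ones of the appended word are among its first \<open>t + 1\<close> letters, and at least
  \<open>t + 2\<close> zeros follow. The last case also drops the first letter after the old marker,
  which shifts the unread part.\<close>

definition letter :: "(nat \<Rightarrow> nat) \<Rightarrow> (nat \<Rightarrow> nat) \<Rightarrow> (nat \<Rightarrow> nat) \<Rightarrow> nat \<Rightarrow> nat \<Rightarrow> nat" where
  "letter g h x t i =
    (if i < t then x i
     else if i < 3 * t + 3 then
       (if i = t \<or> i = t + choice g h x t \<and> choice g h x t \<le> t then 1 else 0)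
     else if i = 3 * t + 3 then 2
     else x (Suc i - (2 * t + 3)))"

text \<open>
  A point \<open>u 2 y\<close> with \<open>u\<close> a word of length \<open>t\<close> in the letters \<open>0\<close>, \<open>1\<close> is mapped to \<open>u v 2 y'\<close>
  with the first letter deleted, where \<open>y'\<close> is the shift of \<open>y\<close> and the word \<open>v\<close> of length
  \<open>2 t + 3\<close> is zero except for a \<open>1\<close> at \<open>0\<close> and at \<open>choice g h x t\<close>. Reading \<open>x\<close> only up to
  \<open>j + 2\<close> when looking for the \<open>2\<close> makes the map the shift where there is no \<open>2\<close>.
\<close>

definition emit :: "(nat \<Rightarrow> nat) \<Rightarrow> (nat \<Rightarrow> nat) \<Rightarrow> (nat \<Rightarrow> nat) \<Rightarrow> nat \<Rightarrow> nat" where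
  "emit g h x j = letter g h x (first_mark x (Suc (Suc j))) (Suc j)"

lemma first_mark_le: "first_mark x m \<le> m"
  unfolding first_mark_def by (rule Least_le) simp

lemma first_mark_cong:
  assumes "agree (Suc m) x y"
  shows "first_mark x m = first_mark y m"
proof -
  have eq: "x i = y i" if "i \<le> m" for i using assms that by (simp add: agree_def)
  have x: "x (first_mark x m) = 2 \<or> first_mark x m = m"
    unfolding first_mark_def by (rule LeastI[of "\<lambda>i. x i = 2 \<or> i = m" m]) simp
  show ?thesis unfolding first_mark_def[of y]
  proof (rule Least_equality[symmetric])
    show "y (first_mark x m) = 2 \<or> first_mark x m = m"
      using x eq[OF first_mark_le] by simp
    fix i assume i: "y i = 2 \<or> i = m"
    show "first_mark x m \<le> i"
    proof (cases "i \<le> m")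
      case True
      then have "x i = 2 \<or> i = m" using i eq by simp
      then show ?thesis unfolding first_mark_def by (rule Least_le)
    qed (use first_mark_le[of x m] in simp)
  qed
qed

text \<open>The marker is searched up to \<open>j + 2\<close>. If it is found at
  \<open>t \<le> j + 1\<close>, then \<open>choice\<close> reads up to \<open>2 * t\<close>, which
  is at most \<open>2 * j + 2\<close>; otherwise only the letter at \<open>j + 1\<close> is
  copied.\<close>

lemma emit_cong:
  assumes "agree (2 * j + 3) x y"
  shows "emit g h x j = emit g h y j"
proof -
  have eq: "x i = y i" if "i < 2 * j + 3" for i using assms that by (simp add: agree_def)
  have fm: "first_mark x (Suc (Suc j)) = first_mark y (Suc (Suc j))"
    by (rule first_mark_cong[OF agree_mono[OF assms]]) simp
  define t where "t = first_mark y (Suc (Suc j))"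
  have "letter g h x t (Suc j) = letter g h y t (Suc j)"
  proof (cases "Suc j < t")
    case True
    then show ?thesis by (simp add: letter_def eq)
  next
    case False
    then have "choice g h x t = choice g h y t" by (simp add: choice_def eq cong: all_cong)
    then show ?thesis using False by (simp add: letter_def eq)
  qed
  then show ?thesis by (simp add: emit_def fm t_def)
qed

lemma agree_emit: "agree (2 * n + 1) x y \<Longrightarrow> agree n (emit g h x) (emit g h y)"
proof -
  assume "agree (2 * n + 1) x y"
  then have "emit g h x j = emit g h y j" if "j < n" for j
    by (rule emit_cong[OF agree_mono]) (use that in simp)
  then show "agree n (emit g h x) (emit g h y)" by (simp add: agree_def)
qed

lemma emit_in_symb: "x \<in> symb 3 \<Longrightarrow> emit g h x \<in> symb 3"
  by (auto simp: symb_def emit_def letter_def)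

lemma symb_continuous_emit: "symb_continuous 3 (emit g h)"
  unfolding symb_continuous_def using emit_in_symb agree_emit by (blast intro: funcsetI)

text \<open>The first \<open>2 * n + 1\<close> letters determine the first \<open>n\<close> letters
  of the image, so the map can be evaluated on the given prefix continued by zeros.\<close>

lemma computable_map_emit:
  assumes g: "recursive g" and h: "recursive h"
  shows "computable_map 3 (emit g h)"
proof -
  define E where "E u = list_encode (map (emit g h (nth_code (p2 u))) [0..<p1 u])" for u
  have rec_first: "recursive (\<lambda>x. first_mark (nth_code (a x)) (b x))"
    if "recursive a" "recursive b" for a b
  proof -
    have "recursive (\<lambda>z. first_mark (nth_code (p1 z)) (p2 z))"
      unfolding first_mark_def by (intro recursive_intro) blast
    from recursive_compose[OF this recursive_pr[OF that]] show ?thesis by simp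
  qed
  have rec_letter: "recursive (\<lambda>x. letter g h (nth_code (a x)) (b x) (c x))"
    if "recursive a" "recursive b" "recursive c" for a b c
  proof -
    have "recursive (\<lambda>z. letter g h (nth_code (p1 z)) (p1 (p2 z)) (p2 (p2 z)))"
      unfolding letter_def choice_def
      by (intro recursive_intro recursive_compose[OF g] recursive_compose[OF h])
    from recursive_compose[OF this recursive_pr[OF that(1) recursive_pr[OF that(2,3)]]]
    show ?thesis by simp
  qed
  have "recursive E" unfolding E_def emit_def
    by (intro recursive_intro rec_letter rec_first)
  then obtain c where c: "\<And>f u. run c f u = Some (E u)" unfolding recursive_def by metis
  have "E (prod_encode (n, prefix_code x (2 * n + 1))) = prefix_code (emit g h x) n" for x n
  proof -
    have "agree (2 * n + 1) (nth_code (prefix_code x (2 * n + 1))) x"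
      unfolding agree_def prefix_code_def nth_code_list_encode
      by (simp del: upt_Suc add_Suc_right)
    then have "agree n (emit g h (nth_code (prefix_code x (2 * n + 1)))) (emit g h x)"
      by (rule agree_emit)
    then have "map (emit g h (nth_code (prefix_code x (2 * n + 1)))) [0..<n] =
        map (emit g h x) [0..<n]"
      by (intro map_cong) (auto simp: agree_def)
    then show ?thesis
      unfolding E_def pr_def[symmetric] p1_pr p2_pr prefix_code_def[of "emit g h x"]
      by (rule arg_cong)
  qed
  moreover have "mono (\<lambda>n::nat. 2 * n + 1)" by (simp add: mono_def)
  moreover have "computable_fun (\<lambda>n. 2 * n + 1)"
    by (rule recursive_imp_computable_fun) (intro recursive_intro)
  ultimately show ?thesis
    unfolding computable_map_def
    by (intro conjI funcsetI emit_in_symb exI[of _ "\<lambda>n. 2 * n + 1"] exI[of _ c]) (simp_all only: c simp_thms ball_triv)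
qed

section \<open>Orbits of points that contain a marker\<close>

definition mark :: "(nat \<Rightarrow> nat) \<Rightarrow> nat \<Rightarrow> bool" where
  "mark x t \<longleftrightarrow> x t = 2 \<and> (\<forall>i<t. x i \<noteq> 2)"

lemma mark_exists: "x i = 2 \<Longrightarrow> \<exists>t\<le>i. mark x t"
proof -
  assume i: "x i = 2"
  have "x (LEAST i. x i = 2) = 2" using i by (rule LeastI)
  moreover have "(LEAST i. x i = 2) \<le> i" using i by (rule Least_le)
  moreover have "x j \<noteq> 2" if "j < (LEAST i. x i = 2)" for j using not_less_Least[OF that] .
  ultimately show ?thesis unfolding mark_def by blast
qed

lemma first_mark_eq: "mark x t \<Longrightarrow> first_mark x m = min t m"
  unfolding first_mark_def mark_def
  by (rule Least_equality) (auto simp: min_def intro: leI)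

lemma emit_before: "mark x t \<Longrightarrow> Suc j < t \<Longrightarrow> emit g h x j = x (Suc j)"
  by (simp add: emit_def first_mark_eq letter_def)

lemma emit_from: "mark x t \<Longrightarrow> t \<le> Suc j \<Longrightarrow> emit g h x j = letter g h x t (Suc j)"
  by (simp add: emit_def first_mark_eq min_def)

lemma mark_emit: "mark x t \<Longrightarrow> mark (emit g h x) (3 * t + 2)"
proof -
  assume x: "mark x t"
  have "emit g h x j \<noteq> 2" if "j < 3 * t + 2" for j
  proof (cases "Suc j < t")
    case True
    then show ?thesis using x by (simp add: emit_before) (simp add: mark_def)
  next
    case False
    then show ?thesis using that by (simp add: emit_from[OF x] letter_def)
  qed
  moreover have "emit g h x (3 * t + 2) = 2" by (simp add: emit_from[OF x] letter_def)
  ultimately show ?thesis by (simp add: mark_def)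
qed

text \<open>The position of the marker after \<open>s\<close> steps: going from \<open>t\<close> to
  \<open>3 * t + 2\<close> triples \<open>Suc t\<close>.\<close>

definition mark_time :: "nat \<Rightarrow> nat \<Rightarrow> nat" where
  "mark_time t0 s = 3 ^ s * Suc t0 - 1"

text \<open>The time at which the word appended in step \<open>s\<close> arrives at position
  \<open>0\<close>.\<close>

definition front :: "nat \<Rightarrow> nat \<Rightarrow> nat" where
  "front t0 s = s + mark_time t0 s"

lemma mark_time_0 [simp]: "mark_time t0 0 = t0"
  by (simp add: mark_time_def)

lemma mark_time_Suc: "mark_time t0 (Suc s) = 3 * mark_time t0 s + 2"
proof -
  have "0 < 3 ^ s * Suc t0" by simp
  then show ?thesis unfolding mark_time_def power_Suc by linarith
qed

lemma mark_time_ge: "s \<le> mark_time t0 s"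
  by (induction s) (simp_all add: mark_time_Suc)

lemma level_mark_time: "level (mark_time t0 s) = level t0 + s"
  by (induction s) (simp_all add: mark_time_Suc level_step del: add_2_eq_Suc')

lemma front_Suc: "front t0 (Suc s) = front t0 s + 2 * mark_time t0 s + 3"
  by (simp add: front_def mark_time_Suc)

lemma front_mono: "s \<le> s' \<Longrightarrow> front t0 s \<le> front t0 s'"
  by (rule lift_Suc_mono_le[of "front t0"]) (simp_all add: front_Suc)

lemma front_ge: "s \<le> front t0 s"
  by (simp add: front_def)

lemma front_interval:
  assumes "front t0 M \<le> a"
  shows "\<exists>s\<ge>M. front t0 s \<le> a \<and> a < front t0 (Suc s)"
proof -
  define s where "s = (LEAST s. a < front t0 (Suc s))"
  have "a < front t0 (Suc a)" using front_ge[of "Suc a" t0] by simp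
  then have a: "a < front t0 (Suc s)" unfolding s_def by (rule LeastI)
  have "M \<le> s" using front_mono[of "Suc s" M t0] a assms by (metis not_less_eq_eq le_less_trans not_less)
  moreover have "front t0 s \<le> a"
  proof (cases s)
    case 0
    then show ?thesis using \<open>M \<le> s\<close> assms by simp
  next
    case (Suc s')
    then have "\<not> a < front t0 (Suc s')" unfolding s_def using not_less_Least by (metis lessI)
    then show ?thesis using Suc by simp
  qed
  ultimately show ?thesis using a by blast
qed

text \<open>The number written in step \<open>s\<close>, expressed through the initial point: the
  unread part is only shifted, so the letters inspected are letters of \<open>x\<close> itself (see
  \<open>choice_orbit\<close>).\<close>

definition emission ::
    "(nat \<Rightarrow> nat) \<Rightarrow> (nat \<Rightarrow> nat) \<Rightarrow> (nat \<Rightarrow> nat) \<Rightarrow> nat \<Rightarrow> nat \<Rightarrow> nat" where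
  "emission g h x t0 s =
    (if \<forall>i<mark_time t0 s. x (t0 + 1 + s + i) = 0 then h (level t0 + s) else g (level t0 + s))"

context
  fixes g h x :: "nat \<Rightarrow> nat" and t0 :: nat
  assumes mark: "mark x t0"
begin

private abbreviation "X s \<equiv> (emit g h ^^ s) x"
private abbreviation "t s \<equiv> mark_time t0 s"
private abbreviation "fr s \<equiv> front t0 s"
private abbreviation "e s \<equiv> emission g h x t0 s"

lemma mark_orbit: "mark (X s) (t s)"
  by (induction s) (simp_all add: mark mark_time_Suc mark_emit del: add_2_eq_Suc')

lemma orbit_after: "X s (t s + 1 + m) = x (t0 + 1 + s + m)"
proof (induction s arbitrary: m)
  case (Suc s)
  have index: "t (Suc s) + 1 + m = 3 * t s + 3 + m" by (simp add: mark_time_Suc)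
  have "X (Suc s) (t (Suc s) + 1 + m) = emit g h (X s) (3 * t s + 3 + m)"
    unfolding index by simp
  also have "\<dots> = X s (t s + 1 + Suc m)"
    by (simp add: emit_from[OF mark_orbit] letter_def)
  also have "\<dots> = x (t0 + 1 + s + Suc m)" by (rule Suc)
  finally show ?case by simp
qed simp

lemma choice_orbit: "choice g h (X s) (t s) = e s"
  unfolding choice_def emission_def level_mark_time orbit_after by simp

text \<open>Letters before the marker only move to the left. The orbit is therefore described by its
  sequence of first letters \<open>X a 0\<close>.\<close>

lemma orbit_before: "i < t s \<Longrightarrow> X s i = X (s + i) 0"
proof (induction i arbitrary: s)
  case (Suc i)
  then have "X s (Suc i) = X (Suc s) i" by (simp add: emit_before[OF mark_orbit])
  also have "\<dots> = X (Suc s + i) 0" using Suc.prems by (intro Suc.IH) (simp add: mark_time_Suc)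
  finally show ?case by simp
qed simp

text \<open>During these times the word written in step \<open>s\<close> passes position
  \<open>0\<close>. The assumption \<open>s < a\<close> says that it has already been
  written.\<close>

lemma orbit_block:
  assumes "s < a" "fr s \<le> a" "a < fr (Suc s)"
  shows "X a 0 = (if a = fr s \<or> a = fr s + e s \<and> e s \<le> t s then 1 else 0)"
proof -
  \<comment> \<open>The place, just after the word is written, of the letter that is first at time
    \<open>a\<close>.\<close>
  define j where "j = a - Suc s"
  have j: "Suc j = a - s" "Suc s + j = a" using assms(1) by (simp_all add: j_def)
  have t: "t s \<le> Suc j" "Suc j < 3 * t s + 3"
    using assms unfolding j(1) front_Suc by (auto simp: front_def)
  have "j < t (Suc s)" using t(2) by (simp add: mark_time_Suc)
  then have "X a 0 = X (Suc s) j" using orbit_before[of j "Suc s"] unfolding j(2) by simp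
  also have "\<dots> = (if Suc j = t s \<or> Suc j = t s + e s \<and> e s \<le> t s then 1 else 0)"
    using t by (simp add: emit_from[OF mark_orbit] letter_def choice_orbit)
  also have "\<dots> = (if a = fr s \<or> a = fr s + e s \<and> e s \<le> t s then 1 else 0)"
    using assms(1) unfolding j(1) front_def by auto
  finally show ?thesis .
qed

lemma orbit_one:
  assumes "fr M \<le> a" "1 \<le> M"
  shows "X a 0 \<le> 1"
    and "X a 0 = 1 \<Longrightarrow> \<exists>s\<ge>M. a < fr (Suc s) \<and> (a = fr s \<or> a = fr s + e s) \<and> fr s \<le> a \<and> a \<le> fr s + t s"
proof -
  obtain s where s: "M \<le> s" "fr s \<le> a" "a < fr (Suc s)" using front_interval[OF assms(1)] by blast
  have "s < a" using s assms(2) mark_time_ge[of s t0] by (simp add: front_def)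
  note blk = orbit_block[OF this s(2,3)]
  show "X a 0 \<le> 1" unfolding blk by simp
  assume "X a 0 = 1"
  then have "a = fr s \<or> a = fr s + e s \<and> e s \<le> t s" unfolding blk by (simp split: if_splits)
  then show "\<exists>s\<ge>M. a < fr (Suc s) \<and> (a = fr s \<or> a = fr s + e s) \<and> fr s \<le> a \<and> a \<le> fr s + t s"
    using s by (intro exI[of _ s]) auto
qed

text \<open>The ones of word \<open>s\<close> occur no later than \<open>fr s + t s\<close>, and the
  next word starts at \<open>fr s + 2 * t s + 3\<close>. Ones from different words are thus more
  than \<open>t s \<ge> M\<close> apart, so two close ones come from one word.\<close>

lemma orbit_two_ones:
  assumes "fr M \<le> a" "1 \<le> M" "a < a'" "a' - a \<le> M" "X a 0 = 1" "X a' 0 = 1"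
  shows "\<exists>s\<ge>M. a = fr s \<and> a' = fr s + e s \<and> a' < fr (Suc s)"
proof -
  obtain s where s: "M \<le> s" "a < fr (Suc s)" "a = fr s \<or> a = fr s + e s" "fr s \<le> a" "a \<le> fr s + t s"
    using orbit_one(2)[OF assms(1,2,5)] by blast
  have "fr M \<le> a'" using assms(1,3) by simp
  then obtain s' where s': "a' < fr (Suc s')" "a' = fr s' \<or> a' = fr s' + e s'" "fr s' \<le> a'"
    using orbit_one(2)[OF _ assms(2,6)] by blast
  have "\<not> s' < s" using front_mono[of "Suc s'" s t0] s(4) s'(1) assms(3) by auto
  moreover have "\<not> s < s'"
  proof
    assume "s < s'"
    then have "fr (Suc s) \<le> a'" using front_mono[of "Suc s" s' t0] s'(3) by simp
    then show False using s(1,5) assms(4) mark_time_ge[of s t0] unfolding front_Suc by simp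
  qed
  ultimately have "s' = s" by simp
  then show ?thesis using s s' assms(3) by (intro exI[of _ s]) auto
qed

text \<open>Any prefix of a limit point is seen at arbitrarily late times, where
  \<open>orbit_one\<close> and \<open>orbit_two_ones\<close> give the conditions of
  \<open>spikes_iff\<close>.\<close>

lemma omega_limit_subset:
  assumes x: "x \<in> symb 3" and S: "S = {d. \<exists>\<^sub>\<infinity>s. e s = d}" "0 \<in> S"
  shows "omega_limit 3 (emit g h) x \<subseteq> spikes S"
proof
  fix y assume "y \<in> omega_limit 3 (emit g h) x"
  moreover have T: "emit g h \<in> symb 3 \<rightarrow> symb 3" using emit_in_symb by blast
  ultimately have y: "\<exists>\<^sub>\<infinity>n. agree N y (X n)" for N using omega_limit_iff[OF T x] by blast
  \<comment> \<open>For \<open>n \<ge> N\<close> the first \<open>N\<close> letters of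
    \<open>X n\<close> lie before the marker, so they are the first letters at the times from
    \<open>n\<close> on.\<close>
  have window: "\<exists>n. fr M \<le> n \<and> (\<forall>i<N. y i = X (n + i) 0)" for N M
  proof -
    obtain n where n: "n \<ge> max N (fr M)" "agree N y (X n)" using y unfolding INFM_nat_le by blast
    then have "y i = X (n + i) 0" if "i < N" for i
      using orbit_before[of i n] mark_time_ge[of n t0] that by (simp add: agree_def)
    then show ?thesis using n(1) by auto
  qed
  show "y \<in> spikes S" unfolding spikes_iff[OF S(2)]
  proof (intro conjI allI impI)
    fix i
    obtain n where "fr 1 \<le> n" "y i = X (n + i) 0" using window[of 1 "Suc i"] by blast
    then show "y i \<le> 1" using orbit_one(1)[of 1 "n + i"] by simp
  next
    fix p q assume pq: "p < q" "y p = 1" "y q = 1"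
    have "\<exists>s\<ge>M. e s = q - p" for M
    proof -
      define M' where "M' = max M (Suc q)"
      obtain n where n: "fr M' \<le> n" "\<forall>i<Suc q. y i = X (n + i) 0" using window by blast
      have "\<exists>s\<ge>M'. n + p = fr s \<and> n + q = fr s + e s \<and> n + q < fr (Suc s)"
        by (rule orbit_two_ones) (use n pq in \<open>auto simp: M'_def\<close>)
      then show ?thesis unfolding M'_def by force
    qed
    then show "q - p \<in> S" unfolding S(1) INFM_nat_le by simp
  next
    fix p q r assume pqr: "p < q" "q < r" "y p = 1" "y q = 1"
    show "y r \<noteq> 1"
    proof
      assume "y r = 1"
      define M where "M = Suc r"
      obtain n where n: "fr M \<le> n" "\<forall>i<Suc r. y i = X (n + i) 0" using window by blast
      have "\<exists>s\<ge>M. n + p = fr s \<and> n + q = fr s + e s \<and> n + q < fr (Suc s)"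
        by (rule orbit_two_ones) (use n pqr in \<open>auto simp: M_def\<close>)
      moreover have "\<exists>s\<ge>M. n + q = fr s \<and> n + r = fr s + e s \<and> n + r < fr (Suc s)"
        by (rule orbit_two_ones) (use n pqr \<open>y r = 1\<close> in \<open>auto simp: M_def\<close>)
      \<comment> \<open>The middle one would be inside the word of the first pair and also start the
        word of the second pair.\<close>
      ultimately obtain s s' where "n + p = fr s" "n + q < fr (Suc s)" "n + q = fr s'" by blast
      then have "fr s < fr s'" "fr s' < fr (Suc s)" using pqr(1) by simp_all
      then show False using front_mono[of s' s t0] front_mono[of "Suc s" s' t0]
        by (metis not_less not_less_eq_eq)
    qed
  qed
qed

text \<open>Shortly before a late word that carries \<open>c\<close> arrives, the orbit shows the
  zero tail of the previous word, then the two ones, then zeros.\<close>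

lemma spike_in_omega_limit:
  assumes x: "x \<in> symb 3" and c: "\<exists>\<^sub>\<infinity>s. e s = c"
  shows "spike j c \<in> omega_limit 3 (emit g h) x"
proof -
  have T: "emit g h \<in> symb 3 \<rightarrow> symb 3" using emit_in_symb by blast
  have "\<exists>n\<ge>M. agree N (spike j c) (X n)" for M N
  proof -
    obtain s where s: "s \<ge> M + j + N + c + 2" "e s = c" using c unfolding INFM_nat_le by blast
    \<comment> \<open>At this time the word of step \<open>s\<close> starts at position
      \<open>j\<close>; the bound on \<open>s\<close> makes its relevant part and the preceding
      zeros long enough.\<close>
    define n where "n = fr s - j"
    have n: "n + j = fr s" "M \<le> n" "N \<le> n" using s(1) front_ge[of s t0] by (auto simp: n_def)
    have ts: "s \<le> t s" by (rule mark_time_ge)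
    obtain s' where s': "s = Suc s'" using s(1) by (cases s) auto
    have "spike j c i = X n i" if i: "i < N" for i
    proof -
      have "X n i = X (n + i) 0" using orbit_before[of i n] mark_time_ge[of n t0] i n(3) by simp
      also have "\<dots> = spike j c i"
      proof (cases "i < j")
        case True
        have ts': "s' \<le> t s'" by (rule mark_time_ge)
        have a: "fr s' + t s' < n + i" using n(1) s(1) ts' unfolding s' front_Suc by simp
        have "X (n + i) 0 = (if n + i = fr s' \<or> n + i = fr s' + e s' \<and> e s' \<le> t s' then 1 else 0)"
        proof (rule orbit_block)
          show "s' < n + i" using a front_ge[of s' t0] by simp
          show "fr s' \<le> n + i" using a by simp
          show "n + i < fr (Suc s')" using True n(1) s' by simp
        qed
        then show ?thesis using a True by (auto simp: spike_def)
      next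
        case False
        have "X (n + i) 0 = (if n + i = fr s \<or> n + i = fr s + e s \<and> e s \<le> t s then 1 else 0)"
        proof (rule orbit_block)
          show "s < n + i" using False n(1) ts s(1) unfolding front_def by simp
          show "fr s \<le> n + i" using False n(1) by simp
          show "n + i < fr (Suc s)" using n(1) i s(1) ts unfolding front_Suc by simp
        qed
        then show ?thesis using n(1) s ts False by (auto simp: spike_def)
      qed
      finally show ?thesis by simp
    qed
    then show ?thesis using n(2) by (auto simp: agree_def)
  qed
  then have "\<exists>\<^sub>\<infinity>n. agree N (spike j c) (X n)" for N unfolding INFM_nat_le by blast
  moreover have "spike j c \<in> symb 3" by (simp add: symb_def spike_def)
  ultimately show ?thesis using omega_limit_iff[OF T x] by blast
qed

lemma omega_limit_emit:
  assumes x: "x \<in> symb 3" and S: "S = {d. \<exists>\<^sub>\<infinity>s. e s = d}" "0 \<in> S"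
  shows "omega_limit 3 (emit g h) x = spikes S"
proof (intro equalityI omega_limit_subset[OF assms] subsetI)
  fix y assume "y \<in> spikes S"
  then consider "y = (\<lambda>_. 0)" | j c where "c \<in> S" "y = spike j c" by (auto simp: spikes_def)
  then show "y \<in> omega_limit 3 (emit g h) x"
  proof cases
    case 1
    have T: "emit g h \<in> symb 3 \<rightarrow> symb 3" using emit_in_symb by blast
    have "\<exists>\<^sub>\<infinity>n. agree N y (X n)" for N
    proof -
      \<comment> \<open>The zero sequence is approximated by \<open>spike N 0\<close>, which is zero
        on its first \<open>N\<close> letters.\<close>
      have "spike N 0 \<in> omega_limit 3 (emit g h) x"
        using spike_in_omega_limit[OF x] S by simp
      then have "\<exists>\<^sub>\<infinity>n. agree N (spike N 0) (X n)" using omega_limit_iff[OF T x] by blast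
      moreover have "agree N y (spike N 0)" using 1 by (simp add: agree_def spike_def)
      ultimately show ?thesis by (elim INFM_mono) (rule agree_trans)
    qed
    then show ?thesis using omega_limit_iff[OF T x] 1 by (simp add: symb_def)
  next
    case 2
    then show ?thesis using spike_in_omega_limit[OF x] S(1) by simp
  qed
qed

end

section \<open>Almost every point and generic points\<close>

lemma AE_mark: "AE x in bernoulli 3. \<exists>t. mark x t"
proof -
  interpret prob_space "bernoulli 3" by (rule prob_space_bernoulli) simp
  define A where "A n = {x \<in> symb 3. \<forall>i\<in>{..<n}. x i \<in> {0, 1}}" for n :: nat
  \<comment> \<open>Two of the three letters are allowed at each of \<open>n\<close> places; the sum
    over \<open>n\<close> converges.\<close>
  have meas: "measure (bernoulli 3) (A n) = (2 / 3) ^ n" for n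
    unfolding A_def by (subst measure_bernoulli_Collect) auto
  have "AE x in bernoulli 3. eventually (\<lambda>n. x \<in> space (bernoulli 3) - A n) sequentially"
  proof (rule borel_cantelli_AE1)
    show "A n \<in> sets (bernoulli 3)" for n unfolding A_def by (rule sets_bernoulli_Collect) simp
    show "emeasure (bernoulli 3) (A n) < \<infinity>" for n by (simp add: less_top[symmetric])
    show "summable (\<lambda>n. measure (bernoulli 3) (A n))" unfolding meas by simp
  qed
  then show ?thesis
  proof eventually_elim
    fix x assume "eventually (\<lambda>n. x \<in> space (bernoulli 3) - A n) sequentially"
    then obtain n where "x \<in> symb 3" "x \<notin> A n"
      unfolding space_bernoulli eventually_sequentially by blast
    then obtain i where "x i \<notin> {0, 1}" "x i < 3" unfolding A_def symb_def by blast
    then have "x i = 2" by auto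
    then show "\<exists>t. mark x t" using mark_exists by blast
  qed
qed

text \<open>Using \<open>h\<close> in step \<open>s\<close> requires
  \<open>mark_time t0 s \<ge> s\<close> zeros, an event of probability at most
  \<open>(1 / 3) ^ s\<close>. With \<open>t0\<close> fixed these are conditions on fixed
  coordinates; the countably many \<open>t0\<close> are combined afterwards.\<close>

lemma AE_eventually_g:
  "AE x in bernoulli 3. eventually (\<lambda>s. emission g h x t0 s = g (level t0 + s)) sequentially"
proof -
  interpret prob_space "bernoulli 3" by (rule prob_space_bernoulli) simp
  define A where
    "A s = {x \<in> symb 3. \<forall>i\<in>{t0 + 1 + s..<t0 + 1 + s + mark_time t0 s}. x i \<in> {0}}" for s
  have meas: "measure (bernoulli 3) (A s) = (1 / 3) ^ mark_time t0 s" for s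
    unfolding A_def by (subst measure_bernoulli_Collect) auto
  have "AE x in bernoulli 3. eventually (\<lambda>s. x \<in> space (bernoulli 3) - A s) sequentially"
  proof (rule borel_cantelli_AE1)
    show "A s \<in> sets (bernoulli 3)" for s unfolding A_def by (rule sets_bernoulli_Collect) simp
    show "emeasure (bernoulli 3) (A s) < \<infinity>" for s by (simp add: less_top[symmetric])
    show "summable (\<lambda>s. measure (bernoulli 3) (A s))" unfolding meas
      by (rule summable_comparison_test'[of "\<lambda>s. (1 / 3) ^ s" 0])
        (auto intro!: power_decreasing mark_time_ge)
  qed
  then show ?thesis
  proof eventually_elim
    fix x assume "eventually (\<lambda>s. x \<in> space (bernoulli 3) - A s) sequentially"
    then show "eventually (\<lambda>s. emission g h x t0 s = g (level t0 + s)) sequentially"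
    proof eventually_elim
      fix s assume "x \<in> space (bernoulli 3) - A s"
      then obtain i where i: "t0 + 1 + s \<le> i" "i < t0 + 1 + s + mark_time t0 s" "x i \<noteq> 0"
        unfolding space_bernoulli A_def by auto
      have "\<not> (\<forall>i<mark_time t0 s. x (t0 + 1 + s + i) = 0)"
      proof
        assume *: "\<forall>i<mark_time t0 s. x (t0 + 1 + s + i) = 0"
        have "i - (t0 + 1 + s) < mark_time t0 s" using i by linarith
        with * have "x (t0 + 1 + s + (i - (t0 + 1 + s))) = 0" by blast
        then show False using i by simp
      qed
      then show "emission g h x t0 s = g (level t0 + s)" unfolding emission_def by (simp only: if_False)
    qed
  qed
qed

lemma INFM_nat_shift: "(\<exists>\<^sub>\<infinity>s. P (m + s)) \<longleftrightarrow> (\<exists>\<^sub>\<infinity>n::nat. P n)"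
proof
  assume L: "\<exists>\<^sub>\<infinity>s. P (m + s)"
  show "\<exists>\<^sub>\<infinity>n. P n" unfolding INFM_nat_le
  proof
    fix k
    obtain s where "s \<ge> k" "P (m + s)" using L unfolding INFM_nat_le by blast
    then show "\<exists>n\<ge>k. P n" by (intro exI[of _ "m + s"]) simp
  qed
next
  assume R: "\<exists>\<^sub>\<infinity>n. P n"
  show "\<exists>\<^sub>\<infinity>s. P (m + s)" unfolding INFM_nat_le
  proof
    fix k
    obtain n where "n \<ge> m + k" "P n" using R unfolding INFM_nat_le by blast
    then show "\<exists>s\<ge>k. P (m + s)" by (intro exI[of _ "n - m"]) simp
  qed
qed

text \<open>Almost surely the written numbers are eventually those of \<open>g\<close> from the
  index \<open>level t0\<close> on, and such a shift does not change which values occur infinitely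
  often.\<close>

lemma metric_attractor_emit:
  assumes S: "\<And>d. d \<in> S \<longleftrightarrow> (\<exists>\<^sub>\<infinity>n. g n = d)" "0 \<in> S"
  shows "metric_attractor 3 (emit g h) (spikes S)"
proof (rule metric_attractorI[OF _ symb_continuous_emit closedin_spikes])
  have "AE x in bernoulli 3. \<forall>t0. eventually (\<lambda>s. emission g h x t0 s = g (level t0 + s)) sequentially"
    unfolding AE_all_countable using AE_eventually_g by blast
  then show "AE x in bernoulli 3. omega_limit 3 (emit g h) x = spikes S"
    using AE_mark AE_space
  proof eventually_elim
    fix x
    assume ev: "\<forall>t0. eventually (\<lambda>s. emission g h x t0 s = g (level t0 + s)) sequentially"
      and "\<exists>t. mark x t" and "x \<in> space (bernoulli 3)"
    then obtain t0 where t0: "mark x t0" and x: "x \<in> symb 3" by (auto simp: space_bernoulli)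
    have "(\<exists>\<^sub>\<infinity>s. emission g h x t0 s = d) \<longleftrightarrow> d \<in> S" for d
    proof -
      have "eventually (\<lambda>s. emission g h x t0 s = d \<longleftrightarrow> g (level t0 + s) = d) sequentially"
        using ev[rule_format, of t0] by eventually_elim simp
      then have "(\<exists>\<^sub>\<infinity>s. emission g h x t0 s = d) \<longleftrightarrow> (\<exists>\<^sub>\<infinity>s. g (level t0 + s) = d)"
        unfolding frequently_def cofinite_eq_sequentially
        using eventually_subst by (simp add: eventually_mono) (smt (verit) eventually_elim2)
      then show ?thesis using S(1) INFM_nat_shift[of "\<lambda>n. g n = d"] by simp
    qed
    then show "omega_limit 3 (emit g h) x = spikes S"
      using omega_limit_emit[OF t0 x, of S g h] S(2) by blast
  qed
qed (simp_all add: S(2))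

lemma emission_cong:
  assumes "agree (t0 + 1 + s + mark_time t0 s) x y"
  shows "emission g h x t0 s = emission g h y t0 s"
  using assms by (simp add: emission_def agree_def cong: all_cong)

text \<open>Writing \<open>d\<close> at some step from \<open>M\<close> on is an open and dense
  condition for each \<open>d \<in> S\<close>. Points satisfying all of them write every element of
  \<open>S\<close> infinitely often, and nothing else, as each written number comes from
  \<open>g\<close> or \<open>h\<close>.\<close>

lemma topological_attractor_emit:
  assumes S: "\<And>d. d \<in> S \<longleftrightarrow> (\<exists>\<^sub>\<infinity>n. g n = d) \<or> (\<exists>\<^sub>\<infinity>n. h n = d)" "0 \<in> S"
  shows "topological_attractor 3 (emit g h) (spikes S)"
proof (rule topological_attractorI[OF closedin_spikes])
  define V where "V d M = {x \<in> symb 3. \<exists>t0. mark x t0 \<and> (\<exists>s\<ge>M. emission g h x t0 s = d)}"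
    for d M :: nat
  \<comment> \<open>The index \<open>n\<close> codes the pair \<open>(d, M)\<close>; for
    \<open>d\<close> outside \<open>S\<close> no condition is imposed.\<close>
  define U where "U n = (if p1 n \<in> S then V (p1 n) (p2 n) else symb 3)" for n
  show "generic (symb_top 3) {x \<in> symb 3. omega_limit 3 (emit g h) x = spikes S}"
  proof (rule genericI_agree[of 3 U])
    have "openin (symb_top 3) (V d M)" for d M
      unfolding openin_symb_iff
    proof (intro conjI ballI)
      fix x assume "x \<in> V d M"
      then obtain t0 s where *: "mark x t0" "s \<ge> M" "emission g h x t0 s = d"
        by (auto simp: V_def)
      have "y \<in> V d M" if y: "y \<in> symb 3" "agree (t0 + 1 + s + mark_time t0 s) x y" for y
      proof -
        have "agree (Suc t0) x y" using agree_mono[OF y(2)] by simp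
        then have "mark y t0" using *(1) unfolding mark_def agree_def by (metis lessI less_SucI)
        then show ?thesis using emission_cong[OF y(2), of g h] * y(1) by (auto simp: V_def)
      qed
      then show "\<exists>n. \<forall>y\<in>symb 3. agree n x y \<longrightarrow> y \<in> V d M" by blast
    qed (auto simp: V_def)
    then show "openin (symb_top 3) (U n)" for n
      using openin_topspace[of "symb_top 3"] by (simp add: U_def)
    have dense: "\<exists>y\<in>V d M. agree N x y" if d: "d \<in> S" and x: "x \<in> symb 3" for d M N x
    proof -
      \<comment> \<open>The prefix of \<open>x\<close> is followed by a \<open>2\<close>, in case it
        contains none, and then by a constant tail. From step \<open>N + 1\<close> on only the tail
        is inspected: zeros select \<open>h\<close>, ones select \<open>g\<close>.\<close>
      define y where "y a i = (if i < N then x i else if i = N then 2 else a)" for a i :: nat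
      have y: "y a \<in> symb 3" "agree N x (y a)" if "a < 2" for a
        using x that by (auto simp: y_def symb_def agree_def)
      have "\<exists>t0\<le>N. mark (y a) t0" for a
        by (rule mark_exists) (simp add: y_def)
      then obtain t0 where t0: "\<And>a. t0 a \<le> N" "\<And>a. mark (y a) (t0 a)" by metis
      have after: "y a (t0 a + 1 + s + i) = a" if "N < s" for a s i
        using that by (simp add: y_def)
      from d consider "\<exists>\<^sub>\<infinity>n. g n = d" | "\<exists>\<^sub>\<infinity>n. h n = d" using S(1) by blast
      then show ?thesis
      proof cases
        case 1
        then have "\<exists>\<^sub>\<infinity>s. g (level (t0 1) + s) = d"
          unfolding INFM_nat_shift[of "\<lambda>n. g n = d"] .
        then obtain s where s: "s \<ge> max M (Suc N)" "g (level (t0 1) + s) = d"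
          unfolding INFM_nat_le by blast
        have "0 < mark_time (t0 1) s" using mark_time_ge[of s "t0 1"] s(1) by simp
        then have "emission g h (y 1) (t0 1) s = d"
          using s after[of s 1] by (auto simp: emission_def)
        then show ?thesis using y[of 1] t0(2)[of 1] s(1) unfolding V_def by auto
      next
        case 2
        then have "\<exists>\<^sub>\<infinity>s. h (level (t0 0) + s) = d"
          unfolding INFM_nat_shift[of "\<lambda>n. h n = d"] .
        then obtain s where s: "s \<ge> max M (Suc N)" "h (level (t0 0) + s) = d"
          unfolding INFM_nat_le by blast
        have "emission g h (y 0) (t0 0) s = d"
          using s after[of s 0] by (auto simp: emission_def)
        then show ?thesis using y[of 0] t0(2)[of 0] s(1) unfolding V_def by auto
      qed
    qed
    show "\<exists>y\<in>U n. agree N x y" if "x \<in> symb 3" for n N x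
      unfolding U_def using dense[OF _ that] that agree_refl[of N x]
      by (simp, blast)
    show "(\<Inter>n. U n) \<subseteq> {x \<in> symb 3. omega_limit 3 (emit g h) x = spikes S}"
    proof
      fix x assume "x \<in> (\<Inter>n. U n)"
      then have "x \<in> U (pr d M)" for d M by blast
      then have V: "x \<in> V d M" if "d \<in> S" for d M using that unfolding U_def by (metis p1_pr p2_pr)
      then obtain t0 where t0: "mark x t0" and x: "x \<in> symb 3" using S(2) by (auto simp: V_def)
      have uniq: "t = t0" if "mark x t" for t
        using t0 that unfolding mark_def by (meson linorder_neqE_nat)
      have "(\<exists>\<^sub>\<infinity>s. emission g h x t0 s = d) \<longleftrightarrow> d \<in> S" for d
      proof
        assume "\<exists>\<^sub>\<infinity>s. emission g h x t0 s = d"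
        then have "\<exists>\<^sub>\<infinity>s. g (level t0 + s) = d \<or> h (level t0 + s) = d"
          by (rule INFM_mono) (auto simp: emission_def split: if_splits)
        then show "d \<in> S"
          unfolding S(1) INFM_disj_distrib INFM_nat_shift[of "\<lambda>n. g n = d"]
            INFM_nat_shift[of "\<lambda>n. h n = d"] .
      next
        assume "d \<in> S"
        then have "\<exists>s\<ge>M. emission g h x t0 s = d" for M
          using V[of d M] uniq unfolding V_def by blast
        then show "\<exists>\<^sub>\<infinity>s. emission g h x t0 s = d" unfolding INFM_nat_le by blast
      qed
      then show "x \<in> {x \<in> symb 3. omega_limit 3 (emit g h) x = spikes S}"
        using omega_limit_emit[OF t0 x, of S g h] S(2) x by blast
    qed
  qed
qed (simp_all add: S(2))

theorem theorem4:
  shows "\<exists>k\<ge>2. \<exists>T' T''.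
    computable_map k T' \<and> computable_map k T'' \<and>
    (\<exists>A. metric_attractor k T' A \<and> computable_closed k A) \<and>
    (\<exists>A. topological_attractor k T' A \<and> Pi_complete k 2 A) \<and>
    (\<exists>A. metric_attractor k T'' A \<and> Pi_complete k 2 A) \<and>
    (\<exists>A. topological_attractor k T'' A \<and> computable_closed k A)"
proof (intro exI conjI)
  have rec_p1: "recursive p1" using recursive_p1[OF recursive_id] .
  have rec_0: "recursive (\<lambda>_. 0)" by (rule recursive_const)
  have inf_p1: "\<exists>\<^sub>\<infinity>n. p1 n = d" for d
  proof -
    have "p1 (pr d n) = d" for n by simp
    moreover have "inj (pr d)" by (auto simp: inj_on_def)
    ultimately show ?thesis unfolding INFM_iff_infinite
      by (intro infinite_super[OF _ range_inj_infinite]) auto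
  qed
  show "(2::nat) \<le> 3" by simp
  show "computable_map 3 (emit (\<lambda>_. 0) list_Pi2)"
    by (rule computable_map_emit[OF rec_0 recursive_list_Pi2])
  show "computable_map 3 (emit list_Pi2 p1)"
    by (rule computable_map_emit[OF recursive_list_Pi2 rec_p1])
  show "metric_attractor 3 (emit (\<lambda>_. 0) list_Pi2) (spikes {0})"
    by (rule metric_attractor_emit) (auto simp: INFM_nat_le)
  show "computable_closed 3 (spikes {0})"
    by (rule computable_closed_spikes) (simp, simp, intro recursive_intro)
  \<comment> \<open>The constant \<open>g\<close> contributes only \<open>0\<close>, which already
    belongs to \<open>univ_Pi2\<close>.\<close>
  show "topological_attractor 3 (emit (\<lambda>_. 0) list_Pi2) (spikes univ_Pi2)"
    by (rule topological_attractor_emit)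
      (auto simp: infinite_list_Pi2 zero_in_univ_Pi2 INFM_const split: if_splits)
  show "Pi_complete 3 2 (spikes univ_Pi2)" "Pi_complete 3 2 (spikes univ_Pi2)"
    by (rule Pi_complete_spikes)+
  show "metric_attractor 3 (emit list_Pi2 p1) (spikes univ_Pi2)"
    by (rule metric_attractor_emit) (simp_all add: infinite_list_Pi2 zero_in_univ_Pi2)
  \<comment> \<open>Since \<open>p1\<close> takes every value infinitely often, the contribution of
    \<open>list_Pi2\<close> is absorbed.\<close>
  show "topological_attractor 3 (emit list_Pi2 p1) (spikes UNIV)"
    by (rule topological_attractor_emit) (simp_all add: inf_p1)
  show "computable_closed 3 (spikes UNIV)"
    by (rule computable_closed_spikes) (simp_all add: recursive_pred_const)
qed

end
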